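(* Let $X$ be a compact metrizable space with a free interval $J$ and let $f:X\to X$ be a continuous map. Assume that $M$ is a minimal set for $f$ which intersects $J$. Then exactly one of the following three statements holds. (1) $M$ is finite. (2) $M$ is a cantoroid and is nowhere dense in $X$. (3) $M$ is a disjoint union of finitely many circles.
   Context: A free interval of a topological space $X$ is an open subset of $X$ homeomorphic to an open interval of the real line. A set $M\subseteq X$ is minimal for $f$ if it is nonempty, closed, $f(M)\subseteq M$, and every point of $M$ has an orbit $\{f^n(x):n\ge 0\}$ dense in $M$. A cantoroid is a compact metrizable space without isolated points in which degenerate (i.e. one-point) connected components are dense (the union of all one-point components is dense). A circle means a homeomorphic copy of the unit circle. *)

theory Defs
  imports "HOL-Analysis.Analysis"
begin

text \<open>Open intervals of the line are the nonempty, open, order-convex subsets, so unbounded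
  intervals are allowed.\<close>

definition free_interval :: "'a topology \<Rightarrow> 'a set \<Rightarrow> bool" where
  "free_interval X J \<longleftrightarrow>
     openin X J \<and>
     (\<exists>I::real set. open I \<and> is_interval I \<and> I \<noteq> {} \<and> subtopology X J homeomorphic_space top_of_set I)"

definition minimal_set :: "'a topology \<Rightarrow> ('a \<Rightarrow> 'a) \<Rightarrow> 'a set \<Rightarrow> bool" where
  "minimal_set X f M \<longleftrightarrow>
     M \<noteq> {} \<and> closedin X M \<and> f ` M \<subseteq> M \<and>
     (\<forall>x\<in>M. subtopology X M closure_of {(f ^^ n) x | n. True} = M)"

definition cantoroid :: "'a topology \<Rightarrow> bool" where
  "cantoroid X \<longleftrightarrow>
     compact_space X \<and> metrizable_space X \<and>
     (\<forall>x\<in>topspace X. \<not> openin X {x}) \<and>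
     X closure_of \<Union>{C \<in> connected_components_of X. \<exists>x. C = {x}} = topspace X"

definition nowhere_dense_in :: "'a topology \<Rightarrow> 'a set \<Rightarrow> bool" where
  "nowhere_dense_in X S \<longleftrightarrow> X interior_of (X closure_of S) = {}"

definition circle_in :: "'a topology \<Rightarrow> 'a set \<Rightarrow> bool" where
  "circle_in X C \<longleftrightarrow>
     C \<subseteq> topspace X \<and> subtopology X C homeomorphic_space top_of_set (sphere (0::complex) 1)"

text \<open>Circles are compact, so in a Hausdorff space a finite disjoint union of them as sets also
  carries the topology of their topological sum.\<close>

definition finite_disjoint_union_of_circles :: "'a topology \<Rightarrow> 'a set \<Rightarrow> bool" where
  "finite_disjoint_union_of_circles X M \<longleftrightarrow>
     (\<exists>\<C>. finite \<C> \<and> pairwise disjnt \<C> \<and> (\<forall>C\<in>\<C>. circle_in X C) \<and> M = \<Union>\<C>)"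

definition exactly_one_of_three :: "bool \<Rightarrow> bool \<Rightarrow> bool \<Rightarrow> bool" where
  "exactly_one_of_three P Q R \<longleftrightarrow>
     (P \<and> \<not> Q \<and> \<not> R) \<or> (\<not> P \<and> Q \<and> \<not> R) \<or> (\<not> P \<and> \<not> Q \<and> R)"

end

theory Submission
  imports Defs
begin

text \<open>
  A minimal map \<open>f\<close> on \<open>M\<close> is irreducible: no proper closed subset maps onto \<open>M\<close>, so a nonempty
  open set \<open>U\<close> never satisfies \<open>f\<^sup>n U \<subseteq> f\<^sup>n V\<close> with \<open>V\<close> disjoint from \<open>U\<close>.

  Suppose that \<open>M\<close> contains an open subinterval \<open>K\<close> of \<open>J\<close>. Irreducibility forbids the return
  maps of \<open>f\<^sup>n\<close> on \<open>K\<close> to fold, so they are injective local homeomorphisms; moreover \<open>x\<close> is the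
  only \<open>f\<^sup>n\<close>-preimage of \<open>f\<^sup>n x\<close> whenever \<open>x\<close> and \<open>f\<^sup>n x\<close> lie in \<open>K\<close>. As every point lies
  in some \<open>f\<^sup>j K\<close> and returns to \<open>K\<close>, the map \<open>f\<close> is a homeomorphism of \<open>M\<close>, and \<open>M\<close> is covered by
  finitely many open arcs \<open>f\<^sup>j K\<close>. Two locally homeomorphic images of the line that meet have a
  union of the same kind, and such an image is a circle if it is compact. Hence a cover with as
  few members as possible consists of disjoint circles.

  Otherwise each point of \<open>M \<inter> J\<close> is a one-point component of \<open>M\<close>. By irreducibility and Baire's
  theorem, the points with singleton \<open>f\<^sup>n\<close>-fibre are dense, and a point that \<open>f\<^sup>n\<close> maps into \<open>J\<close>
  along such a fibre is a one-point component as well; so these are dense. If \<open>M\<close> had interior,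
  an iterate would map an interval of \<open>J\<close> around a point of \<open>M\<close> into \<open>M\<close>; the connected image
  contains an open subset of \<open>M\<close> and thus a one-point component, which would then be an isolated
  point.
\<close>

section \<open>Local homeomorphisms from the line\<close>

text \<open>A homeomorphism from the open set \<open>N\<close> onto an open subset of
  \<open>X\<close>. Images and preimages are taken relative to \<open>N\<close>, so the values of
  \<open>c\<close> outside \<open>N\<close> do not matter and charts can be pasted together.\<close>

definition chart :: "'a topology \<Rightarrow> real set \<Rightarrow> (real \<Rightarrow> 'a) \<Rightarrow> bool" where
  "chart X N c \<longleftrightarrow>
     open N \<and> inj_on c N \<and> (\<forall>U\<subseteq>N. open U \<longrightarrow> openin X (c ` U)) \<and>
     (\<forall>V. openin X V \<longrightarrow> open (N \<inter> c -` V))"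

definition open_curve :: "'a topology \<Rightarrow> (real \<Rightarrow> 'a) \<Rightarrow> bool" where
  "open_curve X c \<longleftrightarrow> (\<forall>t. \<exists>N. t \<in> N \<and> chart X N c)"

lemma chart_cong:
  assumes "chart X N c" "\<And>t. t \<in> N \<Longrightarrow> d t = c t"
  shows "chart X N d"
proof -
  have "N \<inter> d -` V = N \<inter> c -` V" for V using assms by auto
  moreover have "d ` U = c ` U" if "U \<subseteq> N" for U
    using assms(2) that by (auto intro!: image_cong)
  moreover have "inj_on d N = inj_on c N" using assms(2) by (rule inj_on_cong)
  ultimately show ?thesis using assms(1) unfolding chart_def by auto
qed

lemma chart_image_subset: "chart X N c \<Longrightarrow> c ` N \<subseteq> topspace X"
  unfolding chart_def by (meson openin_subset order_refl)

text \<open>A continuous injection between open subsets of the line is an open map, so a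
  reparametrised chart is again a chart.\<close>

lemma chart_comp:
  fixes g :: "real \<Rightarrow> real"
  assumes c: "chart X N c" and S: "open S"
    and g: "continuous_on S g" "inj_on g S" "g ` S \<subseteq> N"
  shows "chart X S (c \<circ> g)"
  unfolding chart_def
proof (intro conjI allI impI)
  show "inj_on (c \<circ> g) S"
    using c g by (auto simp: chart_def intro!: comp_inj_on intro: inj_on_subset)
  fix U assume U: "U \<subseteq> S" "open U"
  then have "open (g ` U)" "g ` U \<subseteq> N"
    using g injective_into_1d_imp_open_map_UNIV by auto
  then show "openin X ((c \<circ> g) ` U)"
    using c by (simp only: chart_def image_comp[symmetric])
next
  fix V assume "openin X V"
  then have "open (N \<inter> c -` V)" using c by (simp add: chart_def)
  then have "open (S \<inter> g -` (N \<inter> c -` V))"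
    using g(1) S by (metis Int_commute continuous_on_open_vimage)
  also have "S \<inter> g -` (N \<inter> c -` V) = S \<inter> (c \<circ> g) -` V" using g(3) by auto
  finally show "open (S \<inter> (c \<circ> g) -` V)" .
qed (fact S)

lemma open_real_contains_interval:
  fixes N :: "real set"
  assumes "open N" "t \<in> N" obtains d
    where "d > 0" "\<And>u. \<bar>u - t\<bar> < d \<Longrightarrow> u \<in> N"
  using assms unfolding open_dist dist_real_def by blast

lemma chart_open_vimage:
  "chart X N c \<Longrightarrow> openin X V \<Longrightarrow> open (N \<inter> c -` V)"
  by (simp add: chart_def)

lemma chart_openin_image:
  "chart X N c \<Longrightarrow> U \<subseteq> N \<Longrightarrow> open U \<Longrightarrow> openin X (c ` U)"
  by (simp add: chart_def)

lemma chart_openin_range: "chart X N c \<Longrightarrow> openin X (c ` N)"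
  by (simp add: chart_def)

lemma chart_homeomorphic_map:
  assumes k: "chart Y N k" and h: "homeomorphic_map Y Z h"
  shows "chart Z N (h \<circ> k)"
  unfolding chart_def
proof (intro conjI allI impI)
  have sub: "k ` N \<subseteq> topspace Y" by (rule chart_image_subset[OF k])
  show "open N" using k by (simp add: chart_def)
  show "inj_on (h \<circ> k) N"
    using k sub homeomorphic_imp_injective_map[OF h]
    by (auto simp: chart_def intro!: comp_inj_on intro: inj_on_subset)
  fix U assume "U \<subseteq> N" "open U"
  then have "openin Y (k ` U)" using k by (simp add: chart_def)
  then have "openin Z (h ` (k ` U))"
    using homeomorphic_imp_open_map[OF h] by (simp add: open_map_def)
  then show "openin Z ((h \<circ> k) ` U)" by (simp only: image_comp)
next
  fix V assume "openin Z V"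
  then have "openin Y {x \<in> topspace Y. h x \<in> V}"
    using openin_continuous_map_preimage[OF homeomorphic_imp_continuous_map[OF h]] by blast
  moreover have "N \<inter> (h \<circ> k) -` V = N \<inter> k -` {x \<in> topspace Y. h x \<in> V}"
    using chart_image_subset[OF k] by auto
  ultimately show "open (N \<inter> (h \<circ> k) -` V)" using chart_open_vimage[OF k] by metis
qed

lemma chart_of_homeomorphic_map:
  assumes "openin X J" "open I" and h: "homeomorphic_map (top_of_set I) (subtopology X J) h"
  shows "chart X I h" "h ` I = J"
proof -
  have J: "topspace (subtopology X J) = J" using openin_subset[OF assms(1)] by auto
  show im: "h ` I = J" using homeomorphic_imp_surjective_map[OF h] unfolding J by simp
  show "chart X I h"
    unfolding chart_def
  proof (intro conjI allI impI assms(2))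
    show "inj_on h I" using homeomorphic_imp_injective_map[OF h] by simp
    fix U assume "U \<subseteq> I" "open U"
    then have "openin (top_of_set I) U" using assms(2) by (simp add: openin_open_eq)
    then have "openin (subtopology X J) (h ` U)"
      using homeomorphic_imp_open_map[OF h] unfolding open_map_def by blast
    then show "openin X (h ` U)" using assms(1) by (simp add: openin_open_subtopology)
  next
    fix V assume "openin X V"
    then have "openin (subtopology X J) (V \<inter> J)" by (metis openin_subtopology)
    then have "openin (top_of_set I) {x \<in> topspace (top_of_set I). h x \<in> V \<inter> J}"
      by (rule openin_continuous_map_preimage[OF homeomorphic_imp_continuous_map[OF h]])
    moreover have "{x \<in> topspace (top_of_set I). h x \<in> V \<inter> J} = I \<inter> h -` V"
      using im by auto
    ultimately show "open (I \<inter> h -` V)" using assms(2) by (metis openin_open_trans)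
  qed
qed

lemma chart_subtopology:
  assumes c: "chart X N c" and M: "c ` N \<subseteq> M"
  shows "chart (subtopology X M) N c"
  unfolding chart_def
proof (intro conjI allI impI)
  show "open N" "inj_on c N" using c by (simp_all add: chart_def)
  show "openin (subtopology X M) (c ` U)" if "U \<subseteq> N" "open U" for U
    using c M that by (intro subset_openin_subtopology) (auto simp: chart_def)
  fix V assume "openin (subtopology X M) V"
  then obtain T where T: "openin X T" "V = T \<inter> M" by (auto simp: openin_subtopology)
  have "N \<inter> c -` V = N \<inter> c -` T" using T(2) M by auto
  then show "open (N \<inter> c -` V)" using chart_open_vimage[OF c T(1)] by metis
qed

lemma chart_continuous_map:
  assumes "chart X N c" shows "continuous_map (top_of_set N) X c"
proof -
  have "open N" using assms by (simp add: chart_def)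
  have "{x \<in> N. c x \<in> V} = N \<inter> c -` V" for V by auto
  then show ?thesis
    using chart_image_subset[OF assms] chart_open_vimage[OF assms] \<open>open N\<close>
    by (auto simp: continuous_map_def openin_open_eq)
qed

text \<open>A rescaled arctangent carries the line into the bounded interval. Parametrising by the
  whole line turns a piece of a chart into an open curve.\<close>

lemma chart_of_interval:
  assumes c: "chart X N c" and ab: "a < b" "{a<..<b} \<subseteq> N"
  obtains k where "chart X UNIV k" "range k \<subseteq> c ` {a<..<b}"
proof -
  define r where "r = (b - a) / pi"
  define \<phi> where "\<phi> = (\<lambda>t. (a + b) / 2 + r * arctan t)"
  have r: "r > 0" "r * (pi / 2) = (b - a) / 2" using ab(1) by (simp_all add: r_def)
  have "\<phi> t \<in> {a<..<b}" for t
  proof -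
    have "r * arctan t < r * (pi / 2)" "r * (- (pi / 2)) < r * arctan t"
      using r(1) arctan_ubound[of t] arctan_lbound[of t]
        by (simp_all only: mult_less_cancel_left_pos minus_divide_left)
    then have "r * arctan t < (b - a) / 2" "- ((b - a) / 2) < r * arctan t"
      using r(2) by (simp_all only: mult_minus_right)
    then show ?thesis by (simp add: \<phi>_def) argo
  qed
  then have range: "range \<phi> \<subseteq> {a<..<b}" by blast
  have "chart X UNIV (c \<circ> \<phi>)"
  proof (rule chart_comp[OF c open_UNIV])
    show "continuous_on UNIV \<phi>" unfolding \<phi>_def by (intro continuous_intros)
    show "inj \<phi>" using r(1) by (auto simp: \<phi>_def inj_def arctan_eq_iff)
    show "range \<phi> \<subseteq> N" using range ab(2) by (rule subset_trans)
  qed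
  moreover have "range (c \<circ> \<phi>) \<subseteq> c ` {a<..<b}" using range by auto
  ultimately show ?thesis by (rule that)
qed

section \<open>Coordinate changes\<close>

text \<open>Since \<open>c\<close> is open on \<open>N\<close>, the preimage of an open set
  \<open>B\<close> under the coordinate of \<open>d\<close> is the preimage of an open subset of
  \<open>X\<close> under \<open>d\<close>. This serves twice: for a second chart \<open>d\<close>,
  and for an iterate of \<open>f\<close> read along a chart.\<close>

lemma chart_transition:
  assumes c: "chart X N c" and d: "\<And>V. openin X V \<Longrightarrow> open (S \<inter> d -` V)"
  shows "open (S \<inter> d -` (c ` N))"
    and "continuous_on (S \<inter> d -` (c ` N)) (inv_into N c \<circ> d)"
proof -
  let ?T = "S \<inter> d -` (c ` N)"
  show "open ?T" using d[OF chart_openin_range[OF c]] .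
  have inj: "inj_on c N" using c by (simp add: chart_def)
  show "continuous_on ?T (inv_into N c \<circ> d)"
    unfolding continuous_on_open_vimage[OF \<open>open ?T\<close>]
  proof (intro allI impI)
    fix B :: "real set" assume "open B"
    then have "open (S \<inter> d -` (c ` (N \<inter> B)))"
      using c d by (auto simp: chart_def)
    also have "S \<inter> d -` (c ` (N \<inter> B)) = (inv_into N c \<circ> d) -` B \<inter> ?T"
      using inj by (auto simp: inv_into_f_f)
    finally show "open ((inv_into N c \<circ> d) -` B \<inter> ?T)" .
  qed
qed

lemma chart_transition_inj:
  "inj_on d S \<Longrightarrow> inj_on (inv_into N c \<circ> d) (S \<inter> d -` (c ` N))"
  by (auto simp: inj_on_def dest!: inv_into_injective)

section \<open>Elementary properties of open curves\<close>

lemma open_curve_openin_image: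
  assumes "open_curve X c" "open U" shows "openin X (c ` U)"
proof -
  have "\<exists>W. openin X W \<and> x \<in> W \<and> W \<subseteq> c ` U"
    if x: "x \<in> c ` U" for x
  proof -
    obtain t where t: "t \<in> U" "x = c t" using x by auto
    obtain N where N: "t \<in> N" "chart X N c" using assms(1) unfolding open_curve_def by blast
    have "openin X (c ` (N \<inter> U))" using N(2) assms(2) by (auto simp: chart_def)
    then show ?thesis using t N by (intro exI[of _ "c ` (N \<inter> U)"]) auto
  qed
  then show ?thesis by (subst openin_subopen) blast
qed

lemma open_curve_open_vimage:
  assumes "open_curve X c" "openin X V" shows "open (c -` V)"
proof (subst open_subopen, intro ballI)
  fix t assume t: "t \<in> c -` V"
  obtain N where N: "t \<in> N" "chart X N c" using assms(1) unfolding open_curve_def by blast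
  then have "open (N \<inter> c -` V)" using assms(2) by (auto simp: chart_def)
  then show "\<exists>T. open T \<and> t \<in> T \<and> T \<subseteq> c -` V" using t N by blast
qed

lemma open_curve_continuous_map:
  assumes "open_curve X c" shows "continuous_map euclideanreal X c"
proof -
  have "c t \<in> topspace X" for t
    using openin_subset[OF open_curve_openin_image[OF assms open_UNIV]] by auto
  then show ?thesis
    using open_curve_open_vimage[OF assms] by (auto simp: continuous_map_def vimage_def)
qed

lemma open_curve_chart:
  assumes "open_curve X c" "open N" "inj_on c N" shows "chart X N c"
  using assms open_curve_openin_image open_curve_open_vimage unfolding chart_def
  by (metis open_Int)

lemma chart_UNIV_open_curve: "chart X UNIV c \<Longrightarrow> open_curve X c"
  unfolding open_curve_def by blast

lemma open_curve_minus:
  assumes "open_curve X c" shows "open_curve X (c \<circ> uminus)"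
  unfolding open_curve_def
proof
  fix t
  obtain N where N: "-t \<in> N" "chart X N c" using assms unfolding open_curve_def by blast
  have "open (uminus ` N)" using N(2) open_negations by (auto simp: chart_def)
  then have "chart X (uminus ` N) (c \<circ> uminus)"
    by (rule chart_comp[OF N(2)]) (auto intro: continuous_on_minus continuous_on_id)
  moreover have "t \<in> uminus ` N" using N(1) by force
  ultimately show "\<exists>N. t \<in> N \<and> chart X N (c \<circ> uminus)" by blast
qed

lemma open_curve_compactin_image:
  "open_curve X c \<Longrightarrow> compact K \<Longrightarrow> compactin X (c ` K)"
  using open_curve_continuous_map image_compactin compactin_euclidean_iff by metis

lemma open_curve_closedin_image:
  "Hausdorff_space X \<Longrightarrow> open_curve X c \<Longrightarrow> compact K \<Longrightarrow> closedin X (c ` K)"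
  using open_curve_compactin_image compactin_imp_closedin by metis

lemma open_curve_closed_vimage:
  assumes "open_curve X c" "closedin X V" shows "closed (c -` V)"
  using closedin_continuous_map_preimage[OF open_curve_continuous_map[OF assms(1)] assms(2)]
  by (simp add: vimage_def)

lemma open_curve_connectedin: "open_curve X c \<Longrightarrow> connectedin X (range c)"
  by (metis connectedin_continuous_map_image open_curve_continuous_map connected_UNIV
      connectedin_iff_connected)

text \<open>The loop is cut off at the first parameter \<open>t\<close> at which the curve returns to a point already
  visited after \<open>p\<close>.\<close>
lemma open_curve_first_return:
  assumes H: "Hausdorff_space X" and c: "open_curve X c" and "p < q" "c p = c q"
  obtains s t where "s < t" "c s = c t" "inj_on c {s..<t}"
proof -
  define T where "T = {t \<in> {p..q}. \<not> inj_on c {p..t}}"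
  have "\<not> inj_on c {p..q}"
    using assms(3,4) inj_onD[of c "{p..q}" p q] by auto
  then have "q \<in> T" using assms(3) by (simp add: T_def)
  have bdd: "bdd_below T" by (auto simp: T_def)
  define t where "t = Inf T"
  have t_le: "t \<le> u" if "u \<in> T" for u using that bdd by (simp add: t_def cInf_lower)
  have "t \<ge> p" unfolding t_def
    using \<open>q \<in> T\<close> by (intro cInf_greatest) (auto simp: T_def)
  have inj: "inj_on c {p..<t}"
  proof (rule inj_onI)
    fix x y assume xy: "x \<in> {p..<t}" "y \<in> {p..<t}" "c x = c y"
    have "max x y < t" using xy by auto
    then have "max x y \<notin> T" using t_le by fastforce
    moreover have "max x y \<in> {p..q}" using xy t_le[OF \<open>q \<in> T\<close>] by auto
    ultimately have "inj_on c {p..max x y}" by (simp add: T_def)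
    then show "x = y" using xy by (auto simp: inj_on_def)
  qed
  \<comment> \<open>If \<open>c t\<close> were a new value, then near \<open>t\<close> the curve
    would be injective and would avoid the compact image of \<open>{p..t - d/2}\<close>. No
    repetition could then first appear just after \<open>t\<close>, although \<open>t\<close> is the
    infimum of \<open>T\<close>.\<close>
  have "c t \<in> c ` {p..<t}"
  proof (rule ccontr)
    assume nc: "c t \<notin> c ` {p..<t}"
    obtain N where N: "t \<in> N" "open N" "inj_on c N"
      using c unfolding open_curve_def chart_def by blast
    then obtain d where d: "d > 0" "\<And>u. \<bar>u - t\<bar> < d \<Longrightarrow> u \<in> N"
      using open_real_contains_interval by blast
    have "closedin X (c ` {p..t - d/2})" using open_curve_closedin_image[OF H c] by simp
    then have "openin X (topspace X - c ` {p..t - d/2})" by blast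
    then have "open (c -` (topspace X - c ` {p..t - d/2}))" using open_curve_open_vimage c by blast
    moreover have "t \<in> c -` (topspace X - c ` {p..t - d/2})"
      using nc d(1) open_curve_continuous_map[OF c] by (fastforce simp: continuous_map_def)
    ultimately obtain e
      where e: "e > 0"
        "\<And>u. \<bar>u - t\<bar> < e \<Longrightarrow> u \<in> c -` (topspace X - c ` {p..t - d/2})"
      using open_real_contains_interval by blast
    have "Inf T < t + min d e" using d e by (simp add: t_def)
    then obtain v where v: "v \<in> T" "v < t + min d e"
      using \<open>q \<in> T\<close> cInf_lessD by blast
    then obtain x y where xy: "x \<in> {p..v}" "y \<in> {p..v}" "x < y" "c x = c y"
      using linorder_inj_onI'[of "{p..v}" c] unfolding T_def by blast
    have "\<not> inj_on c {p..y}"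
      using xy inj_onD[of c "{p..y}" x y] by auto
    then have "y \<in> T" using xy v by (simp add: T_def)
    then have "y \<ge> t" by (rule t_le)
    then have "c y \<notin> c ` {p..t - d/2}" using xy v e(2)[of y] by auto
    then have "x > t - d/2" using xy imageI[of x "{p..t - d/2}" c] by (cases "x \<le> t - d/2") auto
    then have "\<bar>x - t\<bar> < d" "\<bar>y - t\<bar> < d"
      using xy v \<open>y \<ge> t\<close> d(1) by auto
    then have "x \<in> N" "y \<in> N" using d(2) by auto
    then show False using N(3) xy by (auto simp: inj_on_def)
  qed
  then obtain s where "s \<in> {p..<t}" "c s = c t" by auto
  with inj show ?thesis by (intro that[of s t]) (auto intro: inj_on_subset)
qed

section \<open>Non-injective curves are loops\<close>

text \<open>Only the closing point \<open>c s = c t\<close> needs care. There the branch at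
  \<open>s\<close> is read in the coordinate of the branch at \<open>t\<close>: after
  \<open>s\<close> it runs beyond \<open>t\<close>, so by monotonicity before \<open>s\<close> it
  runs back along the end of the loop. Thus the loop contains a neighbourhood of its closing
  point.\<close>

lemma open_curve_loop_open:
  assumes c: "open_curve X c" and st: "s < t" "c s = c t" "inj_on c {s..<t}"
  shows "openin X (c ` {s..t})"
proof -
  obtain N where N: "t \<in> N" "open N" "inj_on c N"
    using c unfolding open_curve_def chart_def by blast
  then obtain d where d: "d > 0" "\<And>u. \<bar>u - t\<bar> < d \<Longrightarrow> u \<in> N"
    using open_real_contains_interval by blast
  \<comment> \<open>At most half the parameter length, so the windows of radius \<open>r\<close>
    about \<open>s\<close> and about \<open>t\<close> are disjoint.\<close>
  define r where "r = min d ((t - s) / 2)"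
  have r: "r > 0" "r \<le> d" using d st by (auto simp: r_def)
  have r2: "r \<le> (t - s) / 2" unfolding r_def by (rule min.cobounded2)
  note r = r r2
  define A where "A = {t - r<..<t + r}"
  have "A \<subseteq> N" using d(2) r(2) by (auto simp: A_def abs_if)
  then have cA: "chart X A c"
    using c N(3) by (intro open_curve_chart) (auto simp: A_def intro: inj_on_subset)
  obtain B where B: "s \<in> B" "chart X B c" using c unfolding open_curve_def by blast
  define g where "g = inv_into A c \<circ> c"
  have "inj_on c B" using B(2) by (simp add: chart_def)
  note tr = chart_transition[OF cA chart_open_vimage[OF B(2)], folded g_def]
    chart_transition_inj[OF this, of A c, folded g_def]
  have "s \<in> B \<inter> c -` (c ` A)" using B(1) st(2) r by (auto simp: A_def)
  then obtain e
    where e: "e > 0"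
      "\<And>u. \<bar>u - s\<bar> < e \<Longrightarrow> u \<in> B \<inter> c -` (c ` A)"
    using open_real_contains_interval[OF tr(1)] by blast
  define e' where "e' = min e r"
  have e': "e' > 0" "e' \<le> e" "e' \<le> r" using e r by (auto simp: e'_def)
  have gc: "c (g u) = c u" "g u \<in> A" if "\<bar>u - s\<bar> < e'" for u
    using e(2)[of u] that e' by (auto simp: g_def f_inv_into_f inv_into_into)
  have gs: "g s = t"
    using st(2) cA r(1) by (auto simp: g_def A_def chart_def intro!: inv_into_f_eq)
  \<comment> \<open>Otherwise \<open>u\<close> and \<open>g u\<close> would be two parameters in
    \<open>{s..<t}\<close> with the same value, hence equal, although they lie in disjoint
    windows.\<close>
  have gt: "g u > t" if u: "s < u" "u < s + e'" for u
  proof (rule ccontr)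
    assume "\<not> g u > t"
    moreover have "u \<noteq> t" "u < t" using u e' r by auto
    moreover have "g u \<noteq> t" using gc[of u] u st \<open>u < t\<close>
      using inj_onD[OF st(3), of u s] by auto
    moreover have "g u > s" using gc(2)[of u] u r st by (auto simp: A_def)
    ultimately have "g u = u" using gc(1)[of u] u st by (intro inj_onD[OF st(3)]) auto
    moreover have "g u > t - r" using gc(2)[of u] u by (auto simp: A_def)
    ultimately show False using u e' r by auto
  qed
  \<comment> \<open>The coordinate change is continuous and injective, hence strictly monotone. As
    it exceeds \<open>g s = t\<close> to the right of \<open>s\<close>, it stays below
    \<open>t\<close> to the left.\<close>
  have lt: "g u < t" if u: "s - e' < u" "u < s" for u
  proof -
    define v where "v = s + e' / 2"
    have v: "s < v" "v < s + e'" using e' by (auto simp: v_def)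
    have sub: "{u..v} \<subseteq> B \<inter> c -` (c ` A)" using u v e' e(2) by fastforce
    have "(g u < g s \<and> g s < g v) \<or> (g v < g s \<and> g s < g u)"
      using u v sub tr
        by (intro continuous_inj_imp_mono) (auto intro: continuous_on_subset inj_on_subset)
    then show ?thesis using gt[OF v] gs by auto
  qed
  have left: "c u \<in> c ` {s..t}" if u: "s - e' < u" "u < s" for u
  proof -
    have "g u \<in> A" "c (g u) = c u" using gc[of u] u by auto
    then show ?thesis using lt[OF u] r st by (intro image_eqI[of _ _ "g u"]) (auto simp: A_def)
  qed
  have "c ` {s..t} = c ` {s<..<t} \<union> c ` {s - e'<..<s + e'}"
  proof (intro subset_antisym subsetI)
    fix x assume "x \<in> c ` {s..t}"
    then obtain u where "u \<in> {s..t}" "x = c u" by auto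
    then consider "u = s \<or> u = t" | "u \<in> {s<..<t}" by fastforce
    then show "x \<in> c ` {s<..<t} \<union> c ` {s - e'<..<s + e'}"
      using \<open>x = c u\<close> st e' imageI[of s "{s - e'<..<s + e'}" c] by cases auto
  next
    fix x assume "x \<in> c ` {s<..<t} \<union> c ` {s - e'<..<s + e'}"
    then show "x \<in> c ` {s..t}"
    proof
      assume "x \<in> c ` {s - e'<..<s + e'}"
      then obtain u where u: "u \<in> {s - e'<..<s + e'}" "x = c u" by auto
      show ?thesis using left[of u] u e' r by (cases "u < s") auto
    qed auto
  qed
  then show ?thesis
    using open_curve_openin_image[OF c] by (metis open_greaterThanLessThan openin_Un)
qed

lemma clopen_connectedin_subset:
  assumes "closedin X A" "openin X A" "connectedin X C" "A \<inter> C \<noteq> {}"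
  shows "C \<subseteq> A"
  using assms connectedin_clopen_cases[of X C A] by (auto simp: disjnt_def)

text \<open>The loop at the first return is open, and it is closed as a compact set. The connected
  range of the curve meets it and therefore cannot leave it.\<close>

lemma open_curve_not_inj_loop:
  assumes H: "Hausdorff_space X" and c: "open_curve X c" and ni: "\<not> inj c"
  obtains s t where "s < t" "c s = c t" "inj_on c {s..<t}" "range c = c ` {s..t}"
proof -
  obtain p q where "p < q" "c p = c q" using ni linorder_inj_onI'[of UNIV c] by blast
  then obtain s t where st: "s < t" "c s = c t" "inj_on c {s..<t}"
    using open_curve_first_return[OF H c] by blast
  have "range c \<subseteq> c ` {s..t}"
    using st by (intro clopen_connectedin_subset[of X] open_curve_loop_open[OF c]
        open_curve_closedin_image[OF H c] open_curve_connectedin[OF c]) fastforce+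
  with st show ?thesis by (intro that[of s t]) auto
qed

lemma open_curve_not_inj_clopen:
  assumes "Hausdorff_space X" "open_curve X c" "\<not> inj c"
  shows "closedin X (range c)" "openin X (range c)"
proof -
  obtain s t where "range c = c ` {s..t}" using open_curve_not_inj_loop[OF assms] by metis
  then show "closedin X (range c)" using open_curve_closedin_image[OF assms(1,2)] by simp
  show "openin X (range c)" using open_curve_openin_image[OF assms(2)] by simp
qed

text \<open>The loop and the circle are both quotients of \<open>{s..t}\<close> by the
  identification of \<open>s\<close> with \<open>t\<close>. The map \<open>e\<close> therefore
  factors through \<open>c\<close>, and the factor is a continuous bijection from a compact space to
  a Hausdorff space.\<close>

lemma loop_homeomorphic_circle:
  fixes c :: "real \<Rightarrow> 'a"
  assumes H: "Hausdorff_space X" and c: "continuous_map (top_of_set {s..t}) X c"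
    and st: "s < t" "c s = c t" "inj_on c {s..<t}"
  shows "circle_in X (c ` {s..t})"
proof -
  let ?I = "top_of_set {s..t}" and ?C = "subtopology X (c ` {s..t})"
    and ?S = "top_of_set (sphere (0::complex) 1)"
  define e where "e = (\<lambda>u. cis (2 * pi * ((u - s) / (t - s))))"
  have compI: "compact_space ?I" by (simp add: compact_space_subtopology)
  have c': "continuous_map ?I ?C c" using c by (auto simp: continuous_map_in_subtopology)
  have HC: "Hausdorff_space ?C" using H by (rule Hausdorff_space_subtopology)
  have HS: "Hausdorff_space ?S" by (simp add: Hausdorff_space_subtopology)
  have sub: "c ` {s..t} \<subseteq> topspace X" using c by (auto simp: continuous_map_def)
  have qc: "quotient_map ?I ?C c"
    using sub by (intro continuous_imp_quotient_map[OF c' compI HC]) auto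
  have ec: "continuous_map ?I ?S e"
    using st(1) by (auto simp: e_def continuous_map_in_subtopology intro!: continuous_intros)
  have e_surj: "e ` {s..t} = sphere 0 1"
  proof (intro subset_antisym subsetI)
    fix z :: complex assume z: "z \<in> sphere 0 1"
    define a where "a = Arg2pi z / (2 * pi)"
    have a: "0 \<le> a" "a < 1" using Arg2pi[of z] by (auto simp: a_def field_simps)
    have "z = cis (Arg2pi z)" using Arg2pi[of z] z by (simp add: cis_conv_exp is_Arg_def)
    also have "Arg2pi z = 2 * pi * a" by (simp add: a_def)
    finally have "z = e (s + a * (t - s))" using st(1) by (simp add: e_def mult.assoc)
    moreover have "0 \<le> a * (t - s)" "a * (t - s) \<le> t - s"
      using a st(1) by (simp_all add: mult_left_le_one_le)
    then have "s + a * (t - s) \<in> {s..t}" unfolding atLeastAtMost_iff by linarith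
    ultimately show "z \<in> e ` {s..t}" by blast
  qed (auto simp: e_def)
  have e_inj: "inj_on e {s..<t}"
  proof (rule inj_onI)
    fix x y assume xy: "x \<in> {s..<t}" "y \<in> {s..<t}" "e x = e y"
    let ?x = "2 * pi * ((x - s) / (t - s))" and ?y = "2 * pi * ((y - s) / (t - s))"
    have "0 \<le> ?x" "?x < 2 * pi" "0 \<le> ?y" "?y < 2 * pi"
      using xy st(1) by (auto simp: field_simps)
    then have "Arg2pi (cis ?x) = ?x" "Arg2pi (cis ?y) = ?y"
      by (auto intro!: Arg2pi_unique[of 1] simp: cis_conv_exp)
    then have "?x = ?y" using xy(3) unfolding e_def by metis
    then show "x = y" using st(1) by simp
  qed
  have e_st: "e s = e t" using st(1) by (simp add: e_def)
  have fib: "c x = c y \<longleftrightarrow> e x = e y" if "x \<in> {s..t}" "y \<in> {s..t}" for x y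
  proof -
    \<comment> \<open>The representative of \<open>u\<close> in \<open>{s..<t}\<close>, where both
      \<open>c\<close> and \<open>e\<close> are injective.\<close>
    define w where "w = (\<lambda>u. if u = t then s else u)"
    have "w u \<in> {s..<t}" "c (w u) = c u" "e (w u) = e u" if "u \<in> {s..t}" for u
      using that st e_st by (auto simp: w_def)
    then show ?thesis using that st(3) e_inj by (metis inj_on_eq_iff)
  qed
  obtain h
    where h: "continuous_map ?C ?S h" "\<And>x. x \<in> {s..t} \<Longrightarrow> h (c x) = e x"
  proof (rule quotient_map_lift_exists[OF qc ec])
    show "e x = e y" if "x \<in> topspace ?I" "y \<in> topspace ?I" "c x = c y" for x y
      using fib that by simp
  qed simp
  have "homeomorphic_map ?C ?S h"
  proof (rule continuous_imp_homeomorphic_map[OF h(1) _ HS])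
    show "compact_space ?C" using image_compactin[OF _ c, of "{s..t}"] compI
      by (simp add: compactin_subspace subtopology_subtopology)
    show "h ` topspace ?C = topspace ?S"
      using sub h(2) e_surj by (auto simp: image_image Int_absorb1 image_iff)
    show "inj_on h (topspace ?C)" using h(2) fib by (auto simp: inj_on_def)
  qed
  then show ?thesis using sub by (auto simp: circle_in_def homeomorphic_map_imp_homeomorphic_space)
qed

section \<open>Gluing two curves that meet\<close>

text \<open>While \<open>b\<close> approaches its exit point \<open>b t1\<close>, its coordinate
  \<open>g\<close> along \<open>a\<close> must tend to infinity. Hence all of \<open>a\<close> can
  be reparametrised over \<open>{..<t1}\<close> so as to agree with \<open>b\<close> on
  \<open>{t0..<t1}\<close>, and from \<open>t1\<close> on the curve continues along
  \<open>b\<close>.\<close>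

lemma open_curve_extend_increasing:
  assumes H: "Hausdorff_space X" and a: "open_curve X a" "inj a" and b: "open_curve X b" "inj b"
    and t01: "t0 < t1" "b t1 \<notin> range a"
    and g: "continuous_on {t0..<t1} g" "strict_mono_on {t0..<t1} g"
    and ag: "\<And>t. t \<in> {t0..<t1} \<Longrightarrow> a (g t) = b t"
  obtains c where "open_curve X c" "range c = range a \<union> b ` {t0..}"
proof -
  \<comment> \<open>If \<open>g\<close> were bounded by \<open>B\<close>, then \<open>b\<close>
    would stay up to \<open>t1\<close> in a compact arc of \<open>a\<close>; this arc is closed, so
    it would contain \<open>b t1\<close> too.\<close>
  have unbounded: "\<exists>t\<in>{t0..<t1}. g t > B" for B
  proof (rule ccontr)
    assume "\<not> ?thesis"
    then have le: "g t \<le> B" if "t \<in> {t0..<t1}" for t using that by force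
    let ?V = "b -` (a ` {g t0..B})"
    have "closed ?V"
      using open_curve_closed_vimage[OF b(1) open_curve_closedin_image[OF H a(1)]] by simp
    moreover have "{t0..<t1} \<subseteq> ?V"
    proof
      fix t assume t: "t \<in> {t0..<t1}"
      have "g t0 \<le> g t"
        using strict_mono_on_leD[OF g(2), of t0 t] t by auto
      then show "t \<in> ?V" using ag[OF t] le[OF t] by (auto intro!: image_eqI[of _ _ "g t"])
    qed
    ultimately have "closure {t0..<t1} \<subseteq> ?V" by (rule closure_minimal[rotated])
    moreover have "t1 \<in> closure {t0..<t1}" using t01(1) by simp
    ultimately have "t1 \<in> ?V" by blast
    then show False using t01(2) by auto
  qed
  \<comment> \<open>To the left of \<open>t0\<close> the coordinate is prolonged with slope 1, so
    that \<open>G\<close> also takes every value below \<open>g t0\<close> and no part of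
    \<open>a\<close> is lost.\<close>
  define G where "G = (\<lambda>t. if t \<le> t0 then g t0 + t - t0 else g t)"
  have "continuous_on {..<t1} G"
    unfolding G_def
    by (rule continuous_on_cases_le)
      (auto intro!: continuous_intros intro: continuous_on_subset[OF g(1)])
  moreover have "inj_on G {..<t1}"
  proof (rule linorder_inj_onI')
    fix x y assume "x \<in> {..<t1}" "y \<in> {..<t1}" "x < y"
    then show "G x \<noteq> G y"
      using strict_mono_onD[OF g(2), of "max t0 x" y] by (auto simp: G_def max_def split: if_splits)
  qed
  moreover have G_surj: "G ` {..<t1} = UNIV"
  proof (intro subset_antisym subset_UNIV subsetI)
    fix y
    show "y \<in> G ` {..<t1}"
    proof (cases "y \<le> g t0")
      case True
      then show ?thesis using t01(1) by (intro image_eqI[of _ _ "y - g t0 + t0"]) (auto simp: G_def)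
    next
      case False
      obtain u where u: "u \<in> {t0..<t1}" "g u > y" using unbounded by blast
      have "continuous_on {t0..u} g" using u(1) by (intro continuous_on_subset[OF g(1)]) auto
      then obtain t where "t0 \<le> t" "t \<le> u" "g t = y"
        using IVT'[of g t0 y u] False u by auto
      then show ?thesis using u False by (intro image_eqI[of _ _ t]) (auto simp: G_def)
    qed
  qed
  ultimately have aG: "chart X {..<t1} (a \<circ> G)"
    using open_curve_chart[OF a(1) open_UNIV a(2)] by (intro chart_comp) auto
  define c where "c = (\<lambda>t. if t < t1 then a (G t) else b t)"
  have "chart X {..<t1} c" using aG by (rule chart_cong) (auto simp: c_def)
  moreover have "chart X {t0<..} c"
    using open_curve_chart[OF b(1) open_greaterThan inj_on_subset[OF b(2) subset_UNIV]]
    by (rule chart_cong) (auto simp: c_def G_def ag)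
  ultimately have "open_curve X c"
    unfolding open_curve_def
      using t01(1) by (metis greaterThan_iff lessThan_iff not_less order_less_le_trans)
  moreover have "range c = range a \<union> b ` {t0..}"
  proof -
    have "range c = c ` {..<t1} \<union> c ` {t1..}" by (auto simp: image_Un[symmetric] intro: leI)
    also have "c ` {..<t1} = a ` (G ` {..<t1})" by (auto simp: c_def)
    also have "c ` {t1..} = b ` {t1..}" by (auto simp: c_def)
    finally have "range c = range a \<union> b ` {t1..}" by (simp add: G_surj)
    moreover have "b ` {t0..} = b ` {t0..<t1} \<union> b ` {t1..}"
      using t01(1) by (simp add: image_Un[symmetric] ivl_disj_un)
    moreover have "b t \<in> range a" if "t \<in> {t0..<t1}" for t
      using ag[OF that] rangeI[of a "g t"] by simp
    then have "b ` {t0..<t1} \<subseteq> range a" by (rule image_subsetI)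
    ultimately show ?thesis by (simp only: Un_assoc[symmetric] Un_absorb2)
  qed
  ultimately show ?thesis by (rule that)
qed

text \<open>Unless \<open>b\<close> stays in the range of \<open>a\<close>, there is a first exit
  parameter \<open>t1\<close>; it belongs to the closed set \<open>E\<close>, so \<open>b t1\<close>
  is off the range. The coordinate of \<open>b\<close> along \<open>a\<close> is strictly monotone
  before \<open>t1\<close>, and reversing \<open>a\<close> reduces the decreasing case to the
  increasing one.\<close>

lemma open_curve_extend:
  assumes H: "Hausdorff_space X" and a: "open_curve X a" "inj a" and b: "open_curve X b" "inj b"
    and t0: "b t0 \<in> range a"
  obtains c where "open_curve X c" "range c = range a \<union> b ` {t0..}"
proof (cases "b ` {t0..} \<subseteq> range a")
  case True
  then show ?thesis using that[of a] a by blast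
next
  case False
  let ?T = "b -` range a"
  have charts: "chart X UNIV a" "chart X UNIV b" using a b by (simp_all add: open_curve_chart)
  define E where "E = {t0..} - ?T"
  have "open ?T" using chart_transition(1)[OF charts(1) chart_open_vimage[OF charts(2)]] by simp
  then have "closed E" unfolding E_def by (intro closed_Diff) auto
  moreover have E: "E \<noteq> {}" "bdd_below E" using False by (auto simp: E_def)
  ultimately have "Inf E \<in> E" by (intro closed_contains_Inf)
  define t1 where "t1 = Inf E"
  have t1: "t0 \<le> t1" "b t1 \<notin> range a"
    using \<open>Inf E \<in> E\<close> by (auto simp: E_def t1_def)
  then have "t0 < t1" using t0 by (metis order_le_less)
  have "t \<notin> E" if "t < t1" for t
    using that cInf_lower[OF _ E(2)] unfolding t1_def by fastforce
  then have sub: "{t0..<t1} \<subseteq> UNIV \<inter> ?T" by (auto simp: E_def)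
  define g where "g = inv a \<circ> b"
  have g: "continuous_on {t0..<t1} g" "inj_on g {t0..<t1}"
    unfolding g_def using chart_transition(2)[OF charts(1) chart_open_vimage[OF charts(2)]]
      chart_transition_inj[OF b(2)] sub
    by (blast intro: continuous_on_subset inj_on_subset)+
  have ag: "a (g t) = b t" if "t \<in> {t0..<t1}" for t
    using that sub by (auto simp: g_def f_inv_into_f)
  have "strict_mono_on {t0..<t1} g \<or> strict_antimono_on {t0..<t1} g"
    using injective_eq_monotone_map[OF _ g(1)] g(2) by auto
  then show ?thesis
  proof
    assume "strict_mono_on {t0..<t1} g"
    from open_curve_extend_increasing[OF H a b \<open>t0 < t1\<close> t1(2) g(1) this ag] show ?thesis
      using that by blast
  next
    assume anti: "strict_antimono_on {t0..<t1} g"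
    have "strict_mono_on {t0..<t1} (\<lambda>t. - g t)" using anti by (auto simp: monotone_on_def)
    moreover have "continuous_on {t0..<t1} (\<lambda>t. - g t)"
      using g(1) by (rule continuous_on_minus)
    moreover have "inj (a \<circ> uminus)" using a(2) by (simp add: inj_compose)
    moreover have range: "range (a \<circ> uminus) = range a"
      using image_comp[of a uminus UNIV] by simp
    ultimately show ?thesis
      using open_curve_extend_increasing[OF H open_curve_minus[OF a(1)] _ b \<open>t0 < t1\<close>, of "\<lambda>t. - g t"]
        t1(2) ag that by (metis (no_types, lifting) comp_apply minus_minus)
  qed
qed

text \<open>A non-injective curve has clopen range and absorbs every connected set that it meets. If
  both curves are injective, the forward half of \<open>b\<close> is attached to \<open>a\<close>
  first; the result either absorbs \<open>b\<close> or is injective and can be extended along the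
  reversed \<open>b\<close>.\<close>

lemma open_curve_Un:
  assumes H: "Hausdorff_space X" and a: "open_curve X a" and b: "open_curve X b"
    and meet: "range a \<inter> range b \<noteq> {}"
  obtains c where "open_curve X c" "range c = range a \<union> range b"
proof -
  have absorb: "range v \<subseteq> range u"
    if "open_curve X u" "open_curve X v" "range u \<inter> range v \<noteq> {}"
      "\<not> inj u" for u v
    using open_curve_not_inj_clopen[OF H that(1,4)] open_curve_connectedin[OF that(2)] that(3)
    by (intro clopen_connectedin_subset[of X])
  consider "\<not> inj a" | "\<not> inj b" | "inj a" "inj b" by blast
  then show ?thesis
  proof cases
    case 1
    then show ?thesis using absorb[OF a b meet] a that[of a] by blast
  next
    case 2
    then show ?thesis using absorb[OF b a] meet b that[of b] by blast
  next
    case 3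
    obtain u t0 where "a u = b t0" using meet by auto
    then have t0: "b t0 \<in> range a" by (metis rangeI)
    then obtain c where c: "open_curve X c" "range c = range a \<union> b ` {t0..}"
      using open_curve_extend[OF H a 3(1) b 3(2)] by blast
    have "b t0 \<in> range c" using c(2) t0 by auto
    show ?thesis
    proof (cases "inj c")
      case False
      then have "range b \<subseteq> range c"
        using absorb[OF c(1) b] \<open>b t0 \<in> range c\<close> by blast
      then have "range c = range a \<union> range b" using c(2) by blast
      then show ?thesis using c(1) that by blast
    next
      case True
      have "inj (b \<circ> uminus)" "(b \<circ> uminus) (- t0) \<in> range c"
        using 3(2) \<open>b t0 \<in> range c\<close> by (simp_all add: inj_compose)
      then obtain d
        where d: "open_curve X d" "range d = range c \<union> (b \<circ> uminus) ` {- t0..}"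
        using open_curve_extend[OF H c(1) True open_curve_minus[OF b]] by blast
      have "(b \<circ> uminus) ` {- t0..} = b ` {..t0}" by (simp only: image_comp[symmetric]) simp
      moreover have "(UNIV :: real set) = {t0..} \<union> {..t0}" by auto
      then have "range b = b ` {t0..} \<union> b ` {..t0}" by (metis image_Un)
      ultimately have "range d = range a \<union> range b" using d(2) c(2) by (simp only: Un_assoc)
      then show ?thesis using d(1) that by blast
    qed
  qed
qed

section \<open>Compact ranges and finite covers by curves\<close>

text \<open>An injective open curve embeds the line, which is not compact. So the curve is not
  injective, and its range is a loop.\<close>

lemma compactin_open_curve_circle:
  assumes H: "Hausdorff_space X" and c: "open_curve X c" and comp: "compactin X (range c)"
  shows "circle_in X (range c)"
proof -
  have "\<not> inj c"
  proof
    assume inj: "inj c"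
    have "open_map euclideanreal X c"
      using open_curve_openin_image[OF c] by (auto simp: open_map_def)
    then have "embedding_map euclideanreal X c"
      using inj open_curve_continuous_map[OF c] by (intro injective_open_imp_embedding_map) auto
    then have "euclideanreal homeomorphic_space subtopology X (range c)"
      using embedding_map_imp_homeomorphic_space by fastforce
    then show False
      using comp homeomorphic_compact_space compactin_subspace not_compact_space_euclideanreal
        by blast
  qed
  then obtain s t where "s < t" "c s = c t" "inj_on c {s..<t}" "range c = c ` {s..t}"
    using open_curve_not_inj_loop[OF H c] by metis
  then show ?thesis
    using loop_homeomorphic_circle[OF H _, of s t c] open_curve_continuous_map[OF c]
      continuous_map_from_subtopology by metis
qed

text \<open>By induction on the number of members: two members that meet are merged into one. Once
  the members are disjoint, each is the complement of a union of open sets, hence closed and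
  compact, hence a circle.\<close>

lemma finite_disjoint_union_of_circles_cover:
  assumes H: "Hausdorff_space X" and comp: "compact_space X"
    and "finite \<U>"
    and "\<And>U. U \<in> \<U> \<Longrightarrow> \<exists>c. open_curve X c \<and> U = range c"
    and "\<Union>\<U> = topspace X"
  shows "finite_disjoint_union_of_circles X (topspace X)"
  using assms(3-5)
proof (induction "card \<U>" arbitrary: \<U> rule: less_induct)
  case less
  show ?case
  proof (cases "pairwise disjnt \<U>")
    case True
    have op: "openin X U" if "U \<in> \<U>" for U
      using less.prems(2)[OF that] open_curve_openin_image by fastforce
    have "circle_in X U" if U: "U \<in> \<U>" for U
    proof -
      have "\<Union>(\<U> - {U}) = topspace X - U"
        using True U less.prems(3) by (auto simp: pairwise_def disjnt_def)
      moreover have "openin X (\<Union>(\<U> - {U}))" using op by blast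
      ultimately have "closedin X U"
        using op[OF U] by (simp add: closedin_def openin_subset)
      then have "compactin X U" using comp by (simp add: closedin_compact_space)
      then show ?thesis using less.prems(2)[OF U] compactin_open_curve_circle[OF H] by blast
    qed
    then show ?thesis
      using True less.prems unfolding finite_disjoint_union_of_circles_def by metis
  next
    case False
    then obtain A B
      where AB: "A \<in> \<U>" "B \<in> \<U>" "A \<noteq> B" "A \<inter> B \<noteq> {}"
      by (auto simp: pairwise_def disjnt_def)
    then obtain a b where "open_curve X a" "A = range a" "open_curve X b" "B = range b"
      using less.prems(2) by meson
    then obtain c where c: "open_curve X c" "range c = A \<union> B"
      using open_curve_Un[OF H] AB(4) by metis
    let ?V = "insert (A \<union> B) (\<U> - {A, B})"
    have "card ?V \<le> Suc (card (\<U> - {A, B}))" by (rule card_insert_le_m1) auto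
    also have "card (\<U> - {A, B}) = card \<U> - 2" using AB by (subst card_Diff_subset) auto
    also have "card \<U> \<ge> 2" using AB card_mono[OF less.prems(1), of "{A, B}"] by auto
    then have "Suc (card \<U> - 2) < card \<U>" by linarith
    finally have "card ?V < card \<U>" .
    then show ?thesis
    proof (rule less.hyps)
      show "finite ?V" using less.prems(1) by simp
      show "\<exists>c. open_curve X c \<and> U = range c" if "U \<in> ?V" for U
        using that c less.prems(2) by blast
      show "\<Union>?V = topspace X" using AB less.prems(3) by blast
    qed
  qed
qed

lemma circle_in_subtopology:
  assumes "circle_in (subtopology X M) C" shows "circle_in X C"
proof -
  have "C \<subseteq> M" "C \<subseteq> topspace X" using assms by (auto simp: circle_in_def)
  then show ?thesis
    using assms by (simp add: circle_in_def subtopology_subtopology Int_absorb1)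
qed

section \<open>Minimal systems\<close>

text \<open>The image of the piece of the graph beyond the extremum \<open>m\<close> repeats values taken before \<open>m\<close>.\<close>
lemma continuous_fold_greater:
  fixes g :: "real \<Rightarrow> real"
  assumes g: "continuous_on {x..y} g" "g x = g y" and m: "m \<in> {x..y}" "g x < g m"
  obtains U V
    where "open U" "U \<noteq> {}" "U \<subseteq> {x..y}" "V \<subseteq> {x..y}" "U \<inter> V = {}"
      "g ` U \<subseteq> g ` V"
proof (rule that)
  let ?U = "{m<..<y} \<inter> g -` {g x<..<g m}"
  have sub: "{x..m} \<subseteq> {x..y}" "{m..y} \<subseteq> {x..y}" "{m<..<y} \<subseteq> {x..y}"
    using m by auto
  show "open ?U"
    by (rule continuous_open_preimage) (use sub(3) g(1) continuous_on_subset in auto)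
  obtain u where u: "m \<le> u" "u \<le> y" "g u = (g x + g m) / 2"
    using IVT2'[of g y "(g x + g m) / 2" m] m g(2) continuous_on_subset[OF g(1) sub(2)] by auto
  then have "u \<in> ?U" using m(2) g(2) by (auto simp: less_le)
  then show "?U \<noteq> {}" by blast
  show "g ` ?U \<subseteq> g ` {x..m}"
  proof
    fix z assume "z \<in> g ` ?U"
    then have "g x \<le> z" "z \<le> g m" by auto
    then show "z \<in> g ` {x..m}"
      using IVT'[of g x z m] m(1) continuous_on_subset[OF g(1) sub(1)] by auto
  qed
qed (use m in auto)

text \<open>A function with equal end values exceeds them somewhere, falls below them somewhere, or
  is constant. Negation turns the second case into the first; in the third, the interior repeats the
  value at \<open>x\<close>. The sets \<open>U\<close> and \<open>V\<close> are made to contradict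
  irreducibility.\<close>

lemma continuous_fold:
  fixes g :: "real \<Rightarrow> real"
  assumes g: "continuous_on {x..y} g" "g x = g y" and "x < y"
  obtains U V
    where "open U" "U \<noteq> {}" "U \<subseteq> {x..y}" "V \<subseteq> {x..y}" "U \<inter> V = {}"
      "g ` U \<subseteq> g ` V"
proof -
  show ?thesis
  proof (cases "\<exists>m\<in>{x..y}. g x < g m")
    case True
    then obtain m where m: "m \<in> {x..y}" "g x < g m" by (rule bexE)
    show ?thesis by (rule continuous_fold_greater[OF g m]) (rule that)
  next
    case le: False
    show ?thesis
    proof (cases "\<exists>m\<in>{x..y}. g m < g x")
      case True
      then obtain m where m: "m \<in> {x..y}" "g m < g x" by (rule bexE)
      show ?thesis
      proof (rule continuous_fold_greater[OF continuous_on_minus[OF g(1)] _ m(1)])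
        fix U V
        assume UV: "open U" "U \<noteq> {}" "U \<subseteq> {x..y}" "V \<subseteq> {x..y}"
          "U \<inter> V = {}"
          "(\<lambda>t. - g t) ` U \<subseteq> (\<lambda>t. - g t) ` V"
        have "uminus ` ((\<lambda>t. - g t) ` U) \<subseteq> uminus ` ((\<lambda>t. - g t) ` V)"
          using UV(6) by (rule image_mono)
        then have "g ` U \<subseteq> g ` V" by (simp add: image_image)
        then show ?thesis by (rule that[OF UV(1-5)])
      qed (use g(2) m(2) in simp_all)
    next
      case False
      then have eq: "g m = g x" if "m \<in> {x..y}" for m using le that by force
      show ?thesis
      proof (rule that[of "{x<..<y}" "{x}"])
        show "g ` {x<..<y} \<subseteq> g ` {x}"
        proof
          fix z assume "z \<in> g ` {x<..<y}"
          then obtain m where "z = g m" "m \<in> {x<..<y}" by (rule imageE)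
          then show "z \<in> g ` {x}" using eq[of m] by simp
        qed
      qed (use \<open>x < y\<close> in \<open>auto simp: subset_iff\<close>)
    qed
  qed
qed

section \<open>Compact minimal systems and irreducibility\<close>

lemma continuous_map_funpow: "continuous_map X X f \<Longrightarrow> continuous_map X X (f ^^ n)"
proof (induction n)
  case (Suc n)
  then show ?case using continuous_map_compose[of X X "f ^^ n" X f] by (simp add: comp_def)
qed (simp add: id_def)

text \<open>The intrinsic view of a minimal set: \<open>Y\<close> will be \<open>M\<close> with its
  subspace topology, so openness and density are relative to \<open>M\<close>.\<close>

locale minimal_system =
  fixes Y :: "'a topology" and f :: "'a \<Rightarrow> 'a"
  assumes compact: "compact_space Y" and Hausdorff: "Hausdorff_space Y"
    and cont: "continuous_map Y Y f" and nonempty: "topspace Y \<noteq> {}"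
    and dense_orbit:
      "x \<in> topspace Y \<Longrightarrow> Y closure_of {(f ^^ n) x | n. True} = topspace Y"
begin

lemma continuous_iterate: "continuous_map Y Y (f ^^ n)"
  by (rule continuous_map_funpow[OF cont])

lemma iterate_in: "x \<in> topspace Y \<Longrightarrow> (f ^^ n) x \<in> topspace Y"
  using continuous_iterate by (auto simp: continuous_map_def)

lemma closed_map_iterate: "closedin Y A \<Longrightarrow> closedin Y ((f ^^ n) ` A)"
  using continuous_imp_closed_map[OF continuous_iterate compact Hausdorff]
    by (auto simp: closed_map_def)

lemma f_in: "x \<in> topspace Y \<Longrightarrow> f x \<in> topspace Y"
  using cont by (auto simp: continuous_map_def)

lemma closed_map_f: "closedin Y A \<Longrightarrow> closedin Y (f ` A)"
  using continuous_imp_closed_map[OF cont compact Hausdorff] by (auto simp: closed_map_def)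

lemma orbit_meets_open:
  assumes "x \<in> topspace Y" "openin Y U" "U \<noteq> {}"
  obtains n where "(f ^^ n) x \<in> U"
  using dense_orbit[OF assms(1)] assms(2,3) dense_intersects_open[of Y "{(f ^^ n) x | n. True}"]
    by blast

lemma orbit_in_closed:
  assumes "x \<in> topspace Y" "closedin Y A" "\<And>n. (f ^^ n) x \<in> A"
  shows "A = topspace Y"
  using closure_of_minimal[of "{(f ^^ n) x | n. True}" A Y] dense_orbit[OF assms(1)] assms(2,3)
    closedin_subset[OF assms(2)] by auto

text \<open>The image of the space under \<open>f\<close> is closed and contains the orbit of
  \<open>f x\<close>, which is dense.\<close>

lemma iterate_surj: "(f ^^ n) ` topspace Y = topspace Y"
proof (induction n)
  case (Suc n)
  have "f ` topspace Y = topspace Y"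
  proof -
    obtain x where x: "x \<in> topspace Y" using nonempty by blast
    have "(f ^^ n) (f x) \<in> f ` topspace Y" for n
      using iterate_in[OF x, of n] by (metis funpow_swap1 imageI)
    then show ?thesis
      by (rule orbit_in_closed[OF f_in[OF x] closed_map_f[OF closedin_topspace]])
  qed
  then show ?case using Suc by (simp only: funpow.simps image_comp[symmetric])
qed simp

text \<open>If \<open>A\<close> maps onto the whole space, backward orbits can be chosen inside \<open>A\<close>; by compactness
  some forward orbit stays in \<open>A\<close>, and it is dense.\<close>
lemma irreducible:
  assumes A: "closedin Y A" and onto: "f ` A = topspace Y"
  shows "A = topspace Y"
proof -
  have sub: "A \<subseteq> topspace Y" by (rule closedin_subset[OF A])
  define B where "B n = {x \<in> topspace Y. \<forall>i\<le>n. (f ^^ i) x \<in> A}" for n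
  have "closedin Y (B n)" for n
  proof -
    have "B n = topspace Y \<inter> (\<Inter>i\<in>{..n}. {x \<in> topspace Y. (f ^^ i) x \<in> A})"
      by (auto simp: B_def)
    moreover have "closedin Y {x \<in> topspace Y. (f ^^ i) x \<in> A}" for i
      by (rule closedin_continuous_map_preimage[OF continuous_iterate A])
    ultimately show ?thesis by (auto intro!: closedin_Int closedin_INT)
  qed
  moreover have "B n \<noteq> {}" for n
  proof (induction n)
    case 0
    have "A \<noteq> {}" using onto nonempty by (metis image_empty)
    then show ?case using sub by (auto simp: B_def)
  next
    case (Suc n)
    then obtain x where x: "x \<in> B n" by blast
    then have "x \<in> topspace Y" by (simp add: B_def)
    then obtain z where z: "z \<in> A" "f z = x" using onto by (metis imageE)
    have "(f ^^ i) z \<in> A" if "i \<le> Suc n" for i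
      using that z x by (cases i) (auto simp: B_def funpow_swap1)
    then show ?case using z sub by (auto simp: B_def)
  qed
  moreover have "decseq B" by (rule decseq_SucI) (auto simp: B_def)
  ultimately have "(\<Inter>n. B n) \<noteq> {}"
    using compact_space_imp_nest[OF compact, of B] by auto
  then obtain x where "\<And>n. x \<in> B n" by auto
  then have "x \<in> topspace Y" "\<And>n. (f ^^ n) x \<in> A" by (auto simp: B_def)
  then show ?thesis using orbit_in_closed A by blast
qed

lemma irreducible_iterate:
  assumes "closedin Y A" "(f ^^ n) ` A = topspace Y"
  shows "A = topspace Y"
  using assms
proof (induction n arbitrary: A)
  case (Suc n)
  have "(f ^^ n) ` (f ` A) = topspace Y"
    using Suc.prems(2) by (simp add: funpow_Suc_right image_comp del: funpow.simps)
  moreover have "closedin Y (f ` A)" by (rule closed_map_f[OF Suc.prems(1)])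
  ultimately have "f ` A = topspace Y" using Suc.IH by blast
  then show ?case using irreducible Suc.prems(1) by blast
qed simp

text \<open>Otherwise the closed complement of \<open>U\<close>, which contains \<open>V\<close>,
  would have full image under \<open>f ^^ n\<close>.\<close>

lemma iterate_image_not_subset:
  assumes U: "openin Y U" "U \<noteq> {}" and V: "V \<subseteq> topspace Y" "U \<inter> V = {}"
  shows "\<not> (f ^^ n) ` U \<subseteq> (f ^^ n) ` V"
proof
  assume sub: "(f ^^ n) ` U \<subseteq> (f ^^ n) ` V"
  let ?A = "topspace Y - U"
  have "topspace Y = U \<union> ?A" "V \<subseteq> ?A" using V openin_subset[OF U(1)] by auto
  then have "(f ^^ n) ` topspace Y = (f ^^ n) ` ?A" using sub by blast
  then have "(f ^^ n) ` ?A = topspace Y" using iterate_surj by simp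
  moreover have "closedin Y ?A" using U(1) by blast
  ultimately have "?A = topspace Y" using irreducible_iterate by blast
  then show False using U openin_subset[OF U(1)] by auto
qed

text \<open>The witness is the set of points all of whose preimages under \<open>f ^^ n\<close> lie
  in \<open>U\<close>. It is open because \<open>f ^^ n\<close> is a closed map, and nonempty by
  irreducibility.\<close>

lemma iterate_image_contains_open:
  assumes U: "openin Y U" "U \<noteq> {}"
  obtains W where "openin Y W" "W \<noteq> {}" "W \<subseteq> (f ^^ n) ` U"
    "\<And>x. x \<in> topspace Y \<Longrightarrow> (f ^^ n) x \<in> W \<Longrightarrow> x \<in> U"
proof
  let ?W = "topspace Y - (f ^^ n) ` (topspace Y - U)"
  show "openin Y ?W" using closed_map_iterate[of "topspace Y - U" n] U(1) by auto
  show "?W \<noteq> {}"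
    using iterate_image_not_subset[OF U, of "topspace Y - U" n] iterate_in openin_subset[OF U(1)]
      by blast
  show "?W \<subseteq> (f ^^ n) ` U" using iterate_surj[of n] by blast
  show "x \<in> U" if "x \<in> topspace Y" "(f ^^ n) x \<in> ?W" for x using that by blast
qed

text \<open>By density of orbits and compactness, finitely many preimages \<open>P i\<close> cover
  the space. Applying \<open>f ^^ N\<close> to a point of \<open>P i\<close> gives a point of the
  forward image of \<open>U\<close> under \<open>f ^^ (N - i)\<close>.\<close>

lemma finite_iterate_cover:
  assumes U: "openin Y U" "U \<noteq> {}"
  obtains N where "topspace Y = (\<Union>i\<le>N. (f ^^ i) ` U)"
proof -
  define P where "P i = {x \<in> topspace Y. (f ^^ i) x \<in> U}" for i
  have "openin Y (P i)" for i
    unfolding P_def by (rule openin_continuous_map_preimage[OF continuous_iterate U(1)])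
  moreover have "topspace Y \<subseteq> \<Union>(range P)"
  proof
    fix x assume x: "x \<in> topspace Y"
    then obtain n where "(f ^^ n) x \<in> U" using orbit_meets_open[OF _ U] by blast
    then show "x \<in> \<Union>(range P)" using x by (auto simp: P_def)
  qed
  ultimately obtain \<F>
    where "finite \<F>" "\<F> \<subseteq> range P" "topspace Y \<subseteq> \<Union>\<F>"
    using compact unfolding compact_space_alt by (metis (no_types, lifting) rangeE)
  then obtain I where I: "finite I" "topspace Y \<subseteq> (\<Union>i\<in>I. P i)"
    by (metis finite_subset_image)
  \<comment> \<open>The 0 is inserted so that the maximum is taken over a nonempty set.\<close>
  define N where "N = Max (insert 0 I)"
  have "topspace Y \<subseteq> (\<Union>i\<le>N. (f ^^ i) ` U)"
  proof
    fix y assume "y \<in> topspace Y"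
    then obtain x where x: "x \<in> topspace Y" "y = (f ^^ N) x" using iterate_surj[of N] by blast
    then obtain i where i: "i \<in> I" "(f ^^ i) x \<in> U" using I(2) by (auto simp: P_def)
    have "i \<le> N" using i(1) I(1) by (simp add: N_def)
    then have "y = (f ^^ (N - i)) ((f ^^ i) x)"
      using x(2) funpow_add[of "N - i" i f] by simp
    then show "y \<in> (\<Union>i\<le>N. (f ^^ i) ` U)" using i(2) by (intro UN_I[of "N - i"]) auto
  qed
  moreover have "(\<Union>i\<le>N. (f ^^ i) ` U) \<subseteq> topspace Y"
    using iterate_in openin_subset[OF U(1)] by blast
  ultimately show ?thesis using that by blast
qed

section \<open>Isolated points, singleton fibres and degenerate components\<close>

text \<open>An orbit must hit an open point exactly, so that point is periodic; its finite orbit is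
  closed and dense, hence everything.\<close>

lemma no_isolated_point:
  assumes inf: "infinite (topspace Y)" and x: "openin Y {x}"
  shows False
proof -
  have xY: "x \<in> topspace Y" using openin_subset[OF x] by simp
  \<comment> \<open>Starting from \<open>f x\<close> makes the return time \<open>Suc n\<close>
    positive.\<close>
  obtain n where "(f ^^ n) (f x) \<in> {x}"
    using orbit_meets_open[OF f_in[OF xY] x] by blast
  then have per: "(f ^^ Suc n) x = x" by (simp add: funpow_swap1)
  have "{(f ^^ m) x | m. True} \<subseteq> (\<lambda>m. (f ^^ m) x) ` {..n}" (is "?O \<subseteq> _")
  proof clarify
    fix m
    have "(f ^^ m) x = (f ^^ (m mod Suc n)) x" using funpow_mod_eq[OF per] by metis
    moreover have "m mod Suc n \<le> n" using mod_less_divisor[of "Suc n" m] by linarith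
    ultimately show "(f ^^ m) x \<in> (\<lambda>m. (f ^^ m) x) ` {..n}" by auto
  qed
  then have "finite ?O" using finite_surj by blast
  moreover have "?O \<subseteq> topspace Y" using iterate_in[OF xY] by auto
  ultimately have "closedin Y ?O"
    using Hausdorff closedin_Hausdorff_finite by blast
  then have "?O = topspace Y" using dense_orbit[OF xY] closure_of_closedin by metis
  then show False using inf \<open>finite ?O\<close> by simp
qed

text \<open>A Baire argument: \<open>G k\<close> is the union of the open sets whose
  \<open>f ^^ n\<close>-preimage has pairwise distances below \<open>1/(k+1)\<close>. It is dense by
  irreducibility, and the fibre over a point of all \<open>G k\<close> has diameter 0.\<close>

lemma dense_singleton_fibres:
  assumes met: "metrizable_space Y" and V: "openin Y V" "V \<noteq> {}"
  obtains w
    where "w \<in> V"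
      "\<And>x z. x \<in> topspace Y \<Longrightarrow> z \<in> topspace Y \<Longrightarrow> (f ^^ n) x = w \<Longrightarrow> (f ^^ n) z = w \<Longrightarrow> x = z"
proof -
  obtain M d where "Metric_space M d" and Y: "Y = Metric_space.mtopology M d"
    using met unfolding metrizable_space_def by blast
  then interpret Metric_space M d by simp
  define \<W> where "\<W> k = {W. openin Y W \<and>
    (\<forall>x\<in>topspace Y. \<forall>z\<in>topspace Y. (f ^^ n) x \<in> W \<longrightarrow> (f ^^ n) z \<in> W \<longrightarrow> d x z < inverse (real (Suc k)))}" for k
  define G where "G k = \<Union>(\<W> k)" for k
  have "openin Y (G k)" for k unfolding G_def by (rule openin_Union) (auto simp: \<W>_def)
  moreover have "Y closure_of (G k) = topspace Y" for k
    unfolding dense_intersects_open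
  proof (intro allI impI)
    fix T assume T: "openin Y T \<and> T \<noteq> {}"
    then obtain y where y: "y \<in> T" "y \<in> topspace Y" using openin_subset by blast
    then obtain x where x: "x \<in> topspace Y" "(f ^^ n) x = y"
      using iterate_surj[of n] by (metis imageE)
    \<comment> \<open>Half the bound serves as radius, so that any two points of \<open>U\<close>
      are closer than the bound.\<close>
    define U
      where
        "U = {z \<in> topspace Y. (f ^^ n) z \<in> T} \<inter> mball x (inverse (real (Suc k)) / 2)"
    have "openin Y U"
      unfolding U_def using openin_continuous_map_preimage[OF continuous_iterate] T
      by (intro openin_Int) (auto simp: Y)
    moreover have "x \<in> U" using x y by (auto simp: U_def Y)
    ultimately obtain W where W: "openin Y W" "W \<noteq> {}" "W \<subseteq> (f ^^ n) ` U"
      "\<And>z. z \<in> topspace Y \<Longrightarrow> (f ^^ n) z \<in> W \<Longrightarrow> z \<in> U"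
      using iterate_image_contains_open[of U n] by blast
    have "d z z' < inverse (real (Suc k))" if "z \<in> U" "z' \<in> U" for z z'
      using that triangle[of z x z'] commute[of z x] by (auto simp: U_def)
    then have "W \<in> \<W> k" using W by (auto simp: \<W>_def)
    moreover have "W \<subseteq> T" using W(3) by (auto simp: U_def)
    ultimately show "G k \<inter> T \<noteq> {}" using W(2) by (auto simp: G_def)
  qed
  ultimately have G: "openin Y (G k) \<and> Y closure_of (G k) = topspace Y" for k by (rule conjI)
  have "Y closure_of \<Inter>(range G) = topspace Y"
  proof (rule Baire_category)
    show "completely_metrizable_space Y \<or> locally_compact_space Y \<and> regular_space Y"
      using compact_imp_locally_compact_space[OF compact]
        compact_Hausdorff_imp_regular_space[OF compact Hausdorff] by (rule disjI2[OF conjI])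
    show "openin Y T \<and> Y closure_of T = topspace Y" if "T \<in> range G" for T
      using that G by (elim rangeE) simp
  qed simp
  then have "\<Inter>(range G) \<inter> V \<noteq> {}"
    using V unfolding dense_intersects_open by simp
  then obtain w where w: "w \<in> V" "\<And>k. w \<in> G k" by auto
  show ?thesis
  proof (rule that[OF w(1)])
    fix x z assume xz: "x \<in> topspace Y" "z \<in> topspace Y" "(f ^^ n) x = w" "(f ^^ n) z = w"
    have "d x z < inverse (real (Suc k))" for k using w(2)[of k] xz by (auto simp: G_def \<W>_def)
    then have "\<not> 0 < d x z" using reals_Archimedean by (metis not_less_iff_gr_or_eq)
    then have "d x z = 0" by (simp add: order_antisym)
    then show "x = z" using xz by (simp add: Y)
  qed
qed

text \<open>Some iterate carries part of \<open>U\<close> into \<open>P\<close>, and there some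
  \<open>w\<close> has a one-point fibre \<open>{x}\<close> with \<open>x\<close> in
  \<open>U\<close>. A connected set through \<open>x\<close> is mapped onto a connected set through
  \<open>w\<close>, that is onto \<open>{w}\<close>, so it lies in the fibre.\<close>

lemma dense_degenerate_components:
  assumes met: "metrizable_space Y" and P: "openin Y P" "P \<noteq> {}"
    and deg:
      "\<And>w C. w \<in> P \<Longrightarrow> connectedin Y C \<Longrightarrow> w \<in> C \<Longrightarrow> C = {w}"
    and U: "openin Y U" "U \<noteq> {}"
  obtains x
    where "x \<in> U"
      "\<And>C. connectedin Y C \<Longrightarrow> x \<in> C \<Longrightarrow> C = {x}"
proof -
  obtain y where "y \<in> U" "y \<in> topspace Y" using U openin_subset by blast
  then obtain n where n: "(f ^^ n) y \<in> P" using orbit_meets_open[OF _ P] by blast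
  define U' where "U' = U \<inter> {x \<in> topspace Y. (f ^^ n) x \<in> P}"
  have "openin Y U'"
    unfolding U'_def using openin_continuous_map_preimage[OF continuous_iterate P(1)] U(1) by blast
  moreover have "y \<in> U'"
    using n \<open>y \<in> U\<close> \<open>y \<in> topspace Y\<close> by (simp add: U'_def)
  then have "U' \<noteq> {}" by (rule ex_in_conv[THEN iffD1, OF exI])
  ultimately obtain W where W: "openin Y W" "W \<noteq> {}" "W \<subseteq> (f ^^ n) ` U'"
    by (rule iterate_image_contains_open[of U' n])
  obtain w
    where w: "w \<in> W"
      "\<And>x z. x \<in> topspace Y \<Longrightarrow> z \<in> topspace Y \<Longrightarrow> (f ^^ n) x = w \<Longrightarrow> (f ^^ n) z = w \<Longrightarrow> x = z"
    using dense_singleton_fibres[OF met W(1,2), of n] by metis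
  obtain x where x: "x \<in> U'" "w = (f ^^ n) x" using W(3) w(1) by blast
  show ?thesis
  proof (rule that)
    show "x \<in> U" using x(1) by (simp add: U'_def)
    fix C assume C: "connectedin Y C" "x \<in> C"
    have sub: "C \<subseteq> topspace Y" using C(1) connectedin_subset_topspace by blast
    have "connectedin Y ((f ^^ n) ` C)"
      using connectedin_continuous_map_image[OF continuous_iterate C(1)] .
    then have "(f ^^ n) ` C = {w}" using x C(2) deg[of w] by (auto simp: U'_def)
    then show "C = {x}" using w(2) C(2) sub by blast
  qed
qed

section \<open>Minimal systems containing an open arc\<close>

context
  fixes k :: "real \<Rightarrow> 'a"
  assumes k: "chart Y UNIV k"
begin

lemma chart_point_in: "k t \<in> topspace Y"
  using chart_image_subset[OF k] by auto

text \<open>The function \<open>g\<close> is \<open>f ^^ n\<close> in the coordinate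
  \<open>k\<close>, on the open set of parameters that return to the arc. Equal values at the ends
  of an interval inside \<open>S\<close> would produce a fold, which irreducibility forbids.\<close>

lemma return_map:
  fixes n defines "S \<equiv> {t. (f ^^ n) (k t) \<in> range k}"
  obtains g
    where "open S" "continuous_on S g"
      "\<And>t. t \<in> S \<Longrightarrow> k (g t) = (f ^^ n) (k t)"
    "\<And>x y. x < y \<Longrightarrow> {x..y} \<subseteq> S \<Longrightarrow> g x \<noteq> g y"
proof -
  let ?d = "(f ^^ n) \<circ> k"
  define g where "g = inv k \<circ> ?d"
  have "open (UNIV \<inter> ?d -` V)" if "openin Y V" for V
  proof -
    have "openin Y {x \<in> topspace Y. (f ^^ n) x \<in> V}"
      using that openin_continuous_map_preimage[OF continuous_iterate] by blast
    then have "open (UNIV \<inter> k -` {x \<in> topspace Y. (f ^^ n) x \<in> V})"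
      by (rule chart_open_vimage[OF k])
    moreover have
      "UNIV \<inter> k -` {x \<in> topspace Y. (f ^^ n) x \<in> V} = UNIV \<inter> ?d -` V"
      using chart_point_in by auto
    ultimately show ?thesis by metis
  qed
  note tr = chart_transition[OF k this, folded g_def]
  have S: "UNIV \<inter> ?d -` range k = S" by (auto simp: S_def)
  have kg: "k (g t) = (f ^^ n) (k t)" if "t \<in> S" for t
    using that by (auto simp: g_def S_def f_inv_into_f)
  have "g x \<noteq> g y" if xy: "x < y" "{x..y} \<subseteq> S" for x y
  proof
    assume eq: "g x = g y"
    have "continuous_on {x..y} g" using tr(2) xy(2) unfolding S by (rule continuous_on_subset)
    then obtain U V
      where UV: "open U" "U \<noteq> {}" "U \<subseteq> {x..y}" "V \<subseteq> {x..y}"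
        "U \<inter> V = {}" "g ` U \<subseteq> g ` V"
      using continuous_fold[OF _ eq xy(1)] by metis
    have im: "(f ^^ n) ` (k ` A) = k ` (g ` A)" if "A \<subseteq> {x..y}" for A
      using that xy(2) kg by (auto simp: image_image subset_iff intro!: image_cong)
    have "openin Y (k ` U)" using k UV(1) by (simp add: chart_def)
    moreover have "k ` U \<inter> k ` V = {}"
      using k UV(5) by (metis chart_def image_Int image_empty)
    ultimately have "\<not> (f ^^ n) ` (k ` U) \<subseteq> (f ^^ n) ` (k ` V)"
      using UV(2) chart_point_in by (intro iterate_image_not_subset) auto
    moreover have "k ` (g ` U) \<subseteq> k ` (g ` V)" using UV(6) by blast
    ultimately show False using im[OF UV(3)] im[OF UV(4)] by simp
  qed
  with tr kg show ?thesis unfolding S by (intro that[of g]) auto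
qed

text \<open>By local injectivity of the return map, \<open>f ^^ n\<close> maps a small arc about
  \<open>k p\<close> onto an open set. A second preimage \<open>q\<close> would have a neighbourhood
  disjoint from that arc but mapped into its image, against irreducibility.\<close>

lemma return_fibre_singleton:
  assumes p: "(f ^^ n) (k p) \<in> range k"
    and q: "q \<in> topspace Y" "(f ^^ n) q = (f ^^ n) (k p)"
  shows "q = k p"
proof (rule ccontr)
  assume "q \<noteq> k p"
  then obtain A B where AB: "openin Y A" "openin Y B" "k p \<in> A" "q \<in> B" "disjnt A B"
    using Hausdorff q(1) chart_point_in unfolding Hausdorff_space_def by metis
  define S where "S = {t. (f ^^ n) (k t) \<in> range k}"
  obtain g
    where g: "open S" "continuous_on S g"
      "\<And>t. t \<in> S \<Longrightarrow> k (g t) = (f ^^ n) (k t)"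
    "\<And>x y. x < y \<Longrightarrow> {x..y} \<subseteq> S \<Longrightarrow> g x \<noteq> g y"
    using return_map[of n] unfolding S_def by metis
  have "open (S \<inter> k -` A)" using g(1) chart_open_vimage[OF k AB(1)] by auto
  moreover have "p \<in> S \<inter> k -` A" using p AB(3) by (simp add: S_def)
  ultimately obtain e
    where e: "e > 0" "\<And>u. \<bar>u - p\<bar> < e \<Longrightarrow> u \<in> S \<inter> k -` A"
    using open_real_contains_interval by blast
  define I where "I = {p - e<..<p + e}"
  have I: "I \<subseteq> S" "k ` I \<subseteq> A" "p \<in> I" using e by (auto simp: I_def abs_if)
  have "inj_on g I"
  proof (rule linorder_inj_onI')
    fix x y assume "x \<in> I" "y \<in> I" "x < y"
    moreover from this have "{x..y} \<subseteq> I" by (auto simp: I_def)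
    ultimately show "g x \<noteq> g y" using g(4) I(1) by blast
  qed
  then have "open (g ` I)"
    using continuous_on_subset[OF g(2) I(1)]
    by (intro injective_into_1d_imp_open_map_UNIV[of I I g]) (auto simp: I_def)
  then have "openin Y (k ` (g ` I))" using k by (simp add: chart_def)
  moreover have "k ` (g ` I) = (f ^^ n) ` (k ` I)"
    using g(3) I(1) by (auto simp: image_image subset_iff intro!: image_cong)
  ultimately have op: "openin Y ((f ^^ n) ` (k ` I))" by simp
  define U where "U = B \<inter> {z \<in> topspace Y. (f ^^ n) z \<in> (f ^^ n) ` (k ` I)}"
  have "openin Y U"
    unfolding U_def using openin_continuous_map_preimage[OF continuous_iterate op] AB(2) by blast
  moreover have "q \<in> U" using AB(4) q I(3) by (auto simp: U_def)
  moreover have "U \<inter> k ` I = {}" using AB(5) I(2) by (auto simp: U_def disjnt_def)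
  ultimately have "\<not> (f ^^ n) ` U \<subseteq> (f ^^ n) ` (k ` I)"
    using chart_point_in by (intro iterate_image_not_subset) auto
  then show False by (auto simp: U_def)
qed

lemma range_chart_open: "openin Y (range k)"
  using chart_openin_range[OF k] .

text \<open>For injectivity, let \<open>f y = f z\<close> and write \<open>y\<close> and
  \<open>z\<close> as images under \<open>f ^^ j\<close> of a point \<open>k p\<close> of the arc
  and of some \<open>q\<close>. A further iterate \<open>i\<close> brings \<open>f y\<close> back to
  the arc, so the fibre of \<open>f ^^ (i + Suc j)\<close> through \<open>k p\<close> is a singleton
  and \<open>q = k p\<close>.\<close>

lemma homeomorphic_map_if_chart: "homeomorphic_map Y Y f"
proof (rule continuous_imp_homeomorphic_map[OF cont compact Hausdorff])
  show "f ` topspace Y = topspace Y" using iterate_surj[of 1] by simp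
  show "inj_on f (topspace Y)"
  proof (rule inj_onI)
    fix y z assume y: "y \<in> topspace Y" and z: "z \<in> topspace Y" and eq: "f y = f z"
    obtain N where "topspace Y = (\<Union>i\<le>N. (f ^^ i) ` range k)"
      using finite_iterate_cover[OF range_chart_open] by blast
    then obtain j p where j: "y = (f ^^ j) (k p)" using y by auto
    obtain q where q: "q \<in> topspace Y" "z = (f ^^ j) q"
      using z iterate_surj[of j] by (metis imageE)
    obtain i where i: "(f ^^ i) (f y) \<in> range k"
      using orbit_meets_open[OF f_in[OF y] range_chart_open] by blast
    have step: "(f ^^ (i + Suc j)) x = (f ^^ i) (f ((f ^^ j) x))" for x
      by (simp only: funpow_add funpow.simps comp_apply)
    have "(f ^^ (i + Suc j)) (k p) \<in> range k" using i j unfolding step by simp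
    moreover have "(f ^^ (i + Suc j)) q = (f ^^ (i + Suc j)) (k p)"
      using eq j q(2) unfolding step by simp
    ultimately have "q = k p" using return_fibre_singleton q(1) by blast
    then show "y = z" using j q(2) by simp
  qed
qed

text \<open>The homeomorphism \<open>f\<close> transports the arc to open arcs, finitely many of
  which cover the space.\<close>

lemma circles_if_chart: "finite_disjoint_union_of_circles Y (topspace Y)"
proof -
  obtain N where N: "topspace Y = (\<Union>i\<le>N. (f ^^ i) ` range k)"
    using finite_iterate_cover[OF range_chart_open] by blast
  have "chart Y UNIV ((f ^^ i) \<circ> k)" for i
  proof (induction i)
    case 0
    then show ?case using k by (simp add: comp_def)
  next
    case (Suc i)
    then show ?case
      using chart_homeomorphic_map[OF Suc homeomorphic_map_if_chart]
        by (simp only: funpow.simps comp_assoc)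
  qed
  then have "\<exists>c. open_curve Y c \<and> (f ^^ i) ` range k = range c" for i
    using chart_UNIV_open_curve by (metis image_comp)
  then show ?thesis
    using N
      by (intro finite_disjoint_union_of_circles_cover[OF Hausdorff compact, of
        "(\<lambda>i. (f ^^ i) ` range k) ` {..N}"]) auto
qed

end

end

section \<open>Minimal sets meeting a free interval\<close>

lemma minimal_set_system:
  assumes "compact_space X" "Hausdorff_space X" "continuous_map X X f" "minimal_set X f M"
  shows "minimal_system (subtopology X M) f" "topspace (subtopology X M) = M"
proof -
  have M: "M \<noteq> {}" "closedin X M" "f ` M \<subseteq> M"
    "\<And>x. x \<in> M \<Longrightarrow> subtopology X M closure_of {(f ^^ n) x | n. True} = M"
    using assms(4) unfolding minimal_set_def by blast+
  show top: "topspace (subtopology X M) = M"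
    using closedin_subset[OF M(2)] by auto
  show "minimal_system (subtopology X M) f"
  proof
    show "compact_space (subtopology X M)"
      using closedin_compact_space[OF assms(1) M(2)] by (rule compact_space_subtopology)
    show "Hausdorff_space (subtopology X M)" using assms(2) by (rule Hausdorff_space_subtopology)
    show "continuous_map (subtopology X M) (subtopology X M) f"
      using M(3) by (intro continuous_map_into_subtopology continuous_map_from_subtopology assms(3))
        (use top in auto)
    show "topspace (subtopology X M) \<noteq> {}" using M(1) unfolding top .
    show "subtopology X M closure_of {(f ^^ n) x | n. True} = topspace (subtopology X M)"
      if "x \<in> topspace (subtopology X M)" for x
      using that unfolding top by (rule M(4))
  qed
qed

section \<open>Mutual exclusion of the three cases\<close>

lemma circle_in_connectedin_infinite:
  assumes "circle_in X C" shows "connectedin X C" "infinite C"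
proof -
  let ?S = "sphere (0::complex) 1"
  have C: "C \<subseteq> topspace X" "subtopology X C homeomorphic_space top_of_set ?S"
    using assms by (auto simp: circle_in_def)
  have con: "connected ?S" by (rule connected_sphere) simp
  then have "connected_space (top_of_set ?S)"
    using connectedin_iff_connected connectedin_def by blast
  then show "connectedin X C"
    using C homeomorphic_connected_space by (auto simp: connectedin_def)
  obtain h where "homeomorphic_map (subtopology X C) (top_of_set ?S) h"
    using C(2) homeomorphic_space by blast
  then have "h ` C = ?S"
    using homeomorphic_imp_surjective_map C(1) by (fastforce simp: Int_absorb1)
  moreover have "infinite ?S"
  proof
    assume "finite ?S"
    then have "?S = {} \<or> (\<exists>z. ?S = {z})" using connected_finite_iff_sing[OF con] by simp
    moreover have one: "1 \<in> ?S" "-1 \<in> ?S" by simp_all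
    ultimately obtain z where "?S = {z}" by blast
    then have "1 = z" "-1 = z" using one by (simp_all only: singleton_iff)
    then show False by simp
  qed
  ultimately show "infinite C" by (metis finite_imageI)
qed

lemma degenerate_component_iff:
  "(\<exists>C\<in>connected_components_of X. C = {x}) \<longleftrightarrow>
     x \<in> topspace X \<and> (\<forall>C. connectedin X C \<longrightarrow> x \<in> C \<longrightarrow> C = {x})"
proof (intro iffI conjI allI impI)
  assume "\<exists>C\<in>connected_components_of X. C = {x}"
  then have K: "{x} \<in> connected_components_of X" by simp
  then show "x \<in> topspace X" using connected_components_of_subset by blast
  fix C assume C: "connectedin X C" "x \<in> C"
  then have "C \<subseteq> {x}"
    using connected_components_of_maximal[OF K C(1)] by (auto simp: disjnt_def)
  then show "C = {x}" using C(2) by blast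
next
  assume x:
    "x \<in> topspace X \<and> (\<forall>C. connectedin X C \<longrightarrow> x \<in> C \<longrightarrow> C = {x})"
  then have "connected_component_of_set X x = {x}"
    using connectedin_connected_component_of[of X x] connected_component_of_refl[of X x] by auto
  then show "\<exists>C\<in>connected_components_of X. C = {x}"
    using x by (auto simp: connected_components_of_def)
qed

text \<open>Every point of a finite Hausdorff space is isolated.\<close>

lemma cantoroid_infinite:
  assumes "cantoroid X" "topspace X \<noteq> {}" shows "infinite (topspace X)"
proof
  assume fin: "finite (topspace X)"
  obtain x where x: "x \<in> topspace X" using assms(2) by blast
  have "Hausdorff_space X"
    using assms(1) by (simp add: cantoroid_def metrizable_imp_Hausdorff_space)
  then have "closedin X (topspace X - {x})" using fin by (simp add: closedin_Hausdorff_finite)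
  then have "openin X (topspace X - (topspace X - {x}))" by blast
  moreover have "topspace X - (topspace X - {x}) = {x}" using x by blast
  ultimately show False using assms(1) x by (simp add: cantoroid_def)
qed

text \<open>A one-point component would lie on one of the circles, which is connected and
  infinite.\<close>

lemma cantoroid_not_union_of_circles:
  assumes "cantoroid (subtopology X M)" "M \<subseteq> topspace X" "M \<noteq> {}"
  shows "\<not> finite_disjoint_union_of_circles X M"
proof
  assume "finite_disjoint_union_of_circles X M"
  then obtain \<C>
    where \<C>: "\<And>C. C \<in> \<C> \<Longrightarrow> circle_in X C" "M = \<Union>\<C>"
    unfolding finite_disjoint_union_of_circles_def by blast
  let ?Y = "subtopology X M"
  let ?D = "\<Union>{C \<in> connected_components_of ?Y. \<exists>x. C = {x}}"
  have "?Y closure_of ?D = M" using assms by (simp add: cantoroid_def Int_absorb1)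
  then have "?D \<noteq> {}" using assms(3) by (metis closure_of_empty)
  then obtain x where "{x} \<in> connected_components_of ?Y" by auto
  then have x: "x \<in> topspace ?Y"
    "\<And>C. connectedin ?Y C \<Longrightarrow> x \<in> C \<Longrightarrow> C = {x}"
    using degenerate_component_iff[of ?Y x] by auto
  then obtain C where C: "C \<in> \<C>" "x \<in> C" using \<C>(2) by auto
  have "connectedin ?Y C" "infinite C"
    using circle_in_connectedin_infinite[OF \<C>(1)[OF C(1)]] C(1) \<C>(2)
    by (auto simp: connectedin_subtopology)
  then show False using x(2)[of C] C(2) by simp
qed

section \<open>Whether the minimal set contains an arc of the free interval\<close>

text \<open>Arbitrarily close to \<open>w\<close>, on either side, there are points
  \<open>c u\<close> and \<open>c v\<close> outside \<open>M\<close>. Then \<open>M\<close> meets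
  the closed and the open arc between them in the same set, which is clopen in \<open>M\<close>;
  choosing the arc to avoid a given \<open>z\<close> separates \<open>w\<close> from
  \<open>z\<close>.\<close>

lemma totally_disconnected_in_chart:
  assumes H: "Hausdorff_space X" and c: "chart X I c" and cI: "c ` I = J"
    and no:
      "\<And>a b. a < b \<Longrightarrow> {a<..<b} \<subseteq> I \<Longrightarrow> \<not> c ` {a<..<b} \<subseteq> M"
    and w: "w \<in> M \<inter> J" and C: "connectedin (subtopology X M) C" "w \<in> C"
  shows "C = {w}"
proof (rule ccontr)
  assume "C \<noteq> {w}"
  then obtain z where z: "z \<in> C" "z \<noteq> w" using C(2) by blast
  have CX: "C \<subseteq> topspace X"
    using C(1) by (simp add: connectedin_subtopology connectedin_subset_topspace)
  define A where "A = topspace X - {z}"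
  have "openin X A" unfolding A_def
    using z(1) CX H by (intro openin_diff) (auto simp: closedin_Hausdorff_singleton)
  obtain t where t: "t \<in> I" "w = c t" using w cI by blast
  have "open (I \<inter> c -` A)" using chart_open_vimage[OF c \<open>openin X A\<close>] .
  moreover have "t \<in> I \<inter> c -` A" using t z(2) C(2) CX by (auto simp: A_def)
  ultimately obtain e
    where e: "e > 0" "\<And>u. \<bar>u - t\<bar> < e \<Longrightarrow> u \<in> I \<inter> c -` A"
    using open_real_contains_interval by blast
  have "x \<in> I" if "x \<in> {t - e<..<t + e}" for x using e(2)[of x] that by auto
  then have sub: "{t - e<..<t} \<subseteq> I" "{t<..<t + e} \<subseteq> I"
    using e(1) by (simp_all add: subset_iff)
  have "\<not> c ` {t - e<..<t} \<subseteq> M" "\<not> c ` {t<..<t + e} \<subseteq> M"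
    using no[OF _ sub(1)] no[OF _ sub(2)] e(1) by simp_all
  then obtain u v where u: "u \<in> {t - e<..<t}" "c u \<notin> M"
    and v: "v \<in> {t<..<t + e}" "c v \<notin> M"
    unfolding image_subset_iff by blast
  have uv: "{u..v} \<subseteq> I \<inter> c -` A"
  proof
    fix x assume "x \<in> {u..v}"
    then have "\<bar>x - t\<bar> < e" using u(1) v(1) by auto
    then show "x \<in> I \<inter> c -` A" by (rule e(2))
  qed
  have "compactin (top_of_set I) {u..v}" using uv by (simp add: compactin_subtopology)
  then have "closedin X (c ` {u..v})"
    using image_compactin[OF _ chart_continuous_map[OF c]] compactin_imp_closedin[OF H] by blast
  then have "closedin (subtopology X M) (M \<inter> c ` {u..v})"
    by (metis closedin_subtopology_Int_closed)
  moreover have "{u<..<v} \<subseteq> I"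
  proof
    show "x \<in> I" if "x \<in> {u<..<v}" for x
      using that uv by (intro subsetD[of "{u..v}" I]) auto
  qed
  then have "openin X (c ` {u<..<v})" using c by (intro chart_openin_image) auto
  then have "openin (subtopology X M) (M \<inter> c ` {u<..<v})" by (rule openin_subtopology_Int2)
  moreover have "M \<inter> c ` {u..v} = M \<inter> c ` {u<..<v}"
  proof -
    have "{u..v} = insert u (insert v {u<..<v})" using u(1) v(1) by auto
    then have "c ` {u..v} = insert (c u) (insert (c v) (c ` {u<..<v}))" by simp
    then show ?thesis using u(2) v(2) by simp
  qed
  moreover have "w \<in> M \<inter> c ` {u<..<v}" using w t(2) u(1) v(1) by simp
  ultimately have "C \<subseteq> M \<inter> c ` {u<..<v}"
    using C by (intro clopen_connectedin_subset[of "subtopology X M"]) auto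
  then obtain x where "x \<in> {u<..<v}" "z = c x" using z(1) by blast
  then have "z \<in> A" using uv by (simp add: subset_iff)
  then show False by (simp add: A_def)
qed

lemma minimal_set_contains_chart:
  assumes X: "compact_space X" "Hausdorff_space X" and f: "continuous_map X X f"
    and M: "minimal_set X f M"
    and c: "chart X I c" and ab: "a < b" "{a<..<b} \<subseteq> I" "c ` {a<..<b} \<subseteq> M"
  shows "finite_disjoint_union_of_circles X M"
proof -
  interpret minimal_system "subtopology X M" f using minimal_set_system(1)[OF X f M] .
  obtain k where k: "chart X UNIV k" "range k \<subseteq> c ` {a<..<b}"
    using chart_of_interval[OF c ab(1,2)] by blast
  then have "chart (subtopology X M) UNIV k" using ab(3) by (intro chart_subtopology) blast+
  then have "finite_disjoint_union_of_circles (subtopology X M) M"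
    using circles_if_chart minimal_set_system(2)[OF X f M] by simp
  then show ?thesis
    unfolding finite_disjoint_union_of_circles_def using circle_in_subtopology by metis
qed

lemma minimal_set_contains_no_chart:
  assumes X: "compact_space X" "metrizable_space X" and f: "continuous_map X X f"
    and M: "minimal_set X f M"
    and inf: "infinite M" and c: "chart X I c" and J: "c ` I = J" "M \<inter> J \<noteq> {}"
    and no:
      "\<And>a b. a < b \<Longrightarrow> {a<..<b} \<subseteq> I \<Longrightarrow> \<not> c ` {a<..<b} \<subseteq> M"
  shows "cantoroid (subtopology X M)" "nowhere_dense_in X M"
proof -
  let ?Y = "subtopology X M"
  have H: "Hausdorff_space X" using X(2) by (rule metrizable_imp_Hausdorff_space)
  note MS = minimal_set_system[OF X(1) H f M]
  interpret minimal_system ?Y f by (rule MS(1))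
  have clM: "closedin X M" using M by (simp add: minimal_set_def)
  have met: "metrizable_space ?Y" using X(2) by (rule metrizable_space_subtopology)
  have "openin X J" using chart_openin_range[OF c] J(1) by simp
  then have P: "openin ?Y (M \<inter> J)" by (rule openin_subtopology_Int2)
  have deg: "C = {w}" if "w \<in> M \<inter> J" "connectedin ?Y C" "w \<in> C" for w C
    using totally_disconnected_in_chart[OF H c J(1) no that] .
  have iso: "\<not> openin ?Y {x}" for x using no_isolated_point inf MS(2) by metis
  show "cantoroid ?Y"
    unfolding cantoroid_def
  proof (intro conjI ballI compact met iso)
    let ?D = "\<Union>{C \<in> connected_components_of ?Y. \<exists>x. C = {x}}"
    have "?D \<inter> U \<noteq> {}" if U: "openin ?Y U \<and> U \<noteq> {}" for U
    proof -
      obtain x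
        where x: "x \<in> U"
          "\<And>C. connectedin ?Y C \<Longrightarrow> x \<in> C \<Longrightarrow> C = {x}"
        using dense_degenerate_components[OF met P J(2) deg] U by metis
      moreover have "x \<in> topspace ?Y" using x(1) U openin_subset by blast
      ultimately have "{x} \<in> connected_components_of ?Y"
        using degenerate_component_iff[of ?Y x] by auto
      then show ?thesis using x(1) by blast
    qed
    then show "?Y closure_of ?D = topspace ?Y" unfolding dense_intersects_open by blast
  qed
  show "nowhere_dense_in X M"
    unfolding nowhere_dense_in_def closure_of_closedin[OF clM]
  proof (rule ccontr)
    define V where "V = X interior_of M"
    assume "X interior_of M \<noteq> {}"
    then have V: "openin X V" "V \<noteq> {}" "V \<subseteq> M"
      by (simp_all add: V_def interior_of_subset)
    have "openin ?Y V" using V(1,3) by (rule subset_openin_subtopology)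
    obtain w where w: "w \<in> M" "w \<in> J" using J(2) by blast
    obtain n where n: "(f ^^ n) w \<in> V"
      using orbit_meets_open[of w V] w(1) MS(2) \<open>openin ?Y V\<close> V(2) by metis
    obtain t where t: "t \<in> I" "w = c t" using w(2) J(1) by blast
    let ?A = "{x \<in> topspace X. (f ^^ n) x \<in> V}"
    have "openin X ?A" by (rule openin_continuous_map_preimage[OF continuous_map_funpow[OF f] V(1)])
    then have "open (I \<inter> c -` ?A)" by (rule chart_open_vimage[OF c])
    moreover have "t \<in> I \<inter> c -` ?A" using t n w(1) closedin_subset[OF clM] by auto
    ultimately obtain e
      where e: "e > 0" "\<And>u. \<bar>u - t\<bar> < e \<Longrightarrow> u \<in> I \<inter> c -` ?A"
      using open_real_contains_interval by blast
    \<comment> \<open>An interval of parameters whose entire image under \<open>c\<close>, including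
      points outside \<open>M\<close>, is sent by \<open>f ^^ n\<close> into \<open>V\<close> and so
      into \<open>M\<close>.\<close>
    define Q where "Q = {t - e<..<t + e}"
    have Q: "Q \<subseteq> I \<inter> c -` ?A" "t \<in> Q" "open Q" "connected Q"
      using e by (auto simp: Q_def abs_if)
    define L where "L = (f ^^ n) ` (c ` Q)"
    have "L \<subseteq> V" using Q(1) by (auto simp: L_def)
    have "connectedin (top_of_set I) Q" using Q by (simp add: connectedin_subtopology)
    then have "connectedin X L"
      unfolding L_def using chart_continuous_map[OF c] continuous_map_funpow[OF f]
      by (blast intro: connectedin_continuous_map_image)
    then have L: "connectedin ?Y L"
      using \<open>L \<subseteq> V\<close> V(3) by (simp add: connectedin_subtopology)
    have "openin X (c ` Q)" using c Q by (simp add: chart_def)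
    then have "openin ?Y (M \<inter> c ` Q)" by (rule openin_subtopology_Int2)
    moreover have "M \<inter> c ` Q \<noteq> {}" using w(1) t Q(2) by blast
    \<comment> \<open>By irreducibility the connected set \<open>L\<close> contains a nonempty set
      \<open>W\<close> open in \<open>M\<close>. A degenerate component \<open>{x}\<close> with
      \<open>x\<close> in \<open>W\<close> forces \<open>L\<close>, and hence \<open>W\<close>, to
      be \<open>{x}\<close>, an isolated point.\<close>
    ultimately obtain W
      where W: "openin ?Y W" "W \<noteq> {}" "W \<subseteq> (f ^^ n) ` (M \<inter> c ` Q)"
      by (rule iterate_image_contains_open)
    obtain x
      where x: "x \<in> W"
        "\<And>C. connectedin ?Y C \<Longrightarrow> x \<in> C \<Longrightarrow> C = {x}"
      using dense_degenerate_components[OF met P J(2) deg W(1,2)] by metis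
    have "W \<subseteq> L" using W(3) by (auto simp: L_def)
    then have "W = {x}" using x(1) x(2)[OF L] by blast
    then show False using iso W(1) by simp
  qed
qed

theorem theoremB:
  fixes X :: "'a topology" and f :: "'a \<Rightarrow> 'a" and J M :: "'a set"
  assumes "compact_space X" and "metrizable_space X"
    and "free_interval X J"
    and "continuous_map X X f"
    and "minimal_set X f M"
    and "M \<inter> J \<noteq> {}"
  shows "exactly_one_of_three
           (finite M)
           (cantoroid (subtopology X M) \<and> nowhere_dense_in X M)
           (finite_disjoint_union_of_circles X M)"
proof -
  have H: "Hausdorff_space X" using assms(2) by (rule metrizable_imp_Hausdorff_space)
  have M: "M \<noteq> {}" "M \<subseteq> topspace X"
    using assms(5) by (auto simp: minimal_set_def dest: closedin_subset)
  obtain I :: "real set"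
    where I: "open I" "openin X J" "subtopology X J homeomorphic_space top_of_set I"
    using assms(3) unfolding free_interval_def by blast
  then obtain c where "homeomorphic_map (top_of_set I) (subtopology X J) c"
    using homeomorphic_space homeomorphic_space_sym by blast
  then have c: "chart X I c" "c ` I = J" using chart_of_homeomorphic_map[OF I(2,1)] by blast+
  have "\<not> (finite M \<and> cantoroid (subtopology X M))"
    using cantoroid_infinite[of "subtopology X M"] M by (auto simp: Int_absorb1)
  moreover have "\<not> (finite M \<and> finite_disjoint_union_of_circles X M)"
  proof
    assume "finite M \<and> finite_disjoint_union_of_circles X M"
    then obtain \<C>
      where "finite (\<Union>\<C>)" "\<And>C. C \<in> \<C> \<Longrightarrow> circle_in X C"
        "M = \<Union>\<C>"
      unfolding finite_disjoint_union_of_circles_def by blast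
    then show False
      using M(1) circle_in_connectedin_infinite(2)
        by (metis Union_upper empty_Union_conv finite_subset)
  qed
  moreover have "\<not> (cantoroid (subtopology X M) \<and> finite_disjoint_union_of_circles X M)"
    using cantoroid_not_union_of_circles M by blast
  moreover have "finite M \<or> cantoroid (subtopology X M) \<and> nowhere_dense_in X M
    \<or> finite_disjoint_union_of_circles X M"
  \<comment> \<open>If \<open>M\<close> contains an arc of \<open>J\<close> it is a union of
    circles; if not, it is finite or a nowhere dense cantoroid.\<close>
  proof (cases
    "\<exists>a b. a < b \<and> {a<..<b} \<subseteq> I \<and> c ` {a<..<b} \<subseteq> M")
    case True
    then show ?thesis using minimal_set_contains_chart[OF assms(1) H assms(4,5) c(1)] by blast
  next
    case False
    then show ?thesis
      using minimal_set_contains_no_chart[OF assms(1,2,4,5) _ c assms(6)] by blast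
  qed
  ultimately show ?thesis unfolding exactly_one_of_three_def by blast
qed

end
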